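(* Let $\mathbb{F}$ be a field, $\overline{\alpha}\in\mathbb{F}^n$, $\beta\in\mathbb{F}$ and $A=\{\sum_{i=1}^n\alpha_ix_i:\overline{x}\in\{0,1\}^n\}\subseteq\mathbb{F}$ be such that $\beta\notin A$. Then the system $\sum_{i=1}^n\alpha_ix_i-\beta$, $\{x_i^2-x_i\}_{i=1}^n$ has a $\mathrm{poly}(|A|,n)$-explicit roABP-$\mathrm{IPS}_{\mathrm{LIN}}$ refutation of individual degree at most $2$ that is computable by a width-$\mathrm{poly}(|A|,n)$ roABP in any variable order.
   Context: An $\mathrm{IPS}_{\mathrm{LIN}}$ refutation of a single polynomial $f\in\mathbb{F}[x_1,\ldots,x_n]$ together with $\{x_i^2-x_i\}_i$ is a polynomial $C(\overline{x},y,\overline{z})\in\mathbb{F}[x_1,\ldots,x_n,y,z_1,\ldots,z_n]$ that is linear in $(y,\overline{z})$, with $C(\overline{x},0,\overline{0})=0$ and $C(\overline{x},f,x_1^2-x_1,\ldots,x_n^2-x_n)=1$ as polynomial identities; equivalently $C=g(\overline{x})y+\sum_ih_i(\overline{x})z_i$ with $gf+\sum_ih_i(x_i^2-x_i)=1$. It is an roABP-$\mathrm{IPS}_{\mathrm{LIN}}$ refutation when $C$ is given by an roABP in the variables $\overline{x},y,\overline{z}$. A width-$r$ read-once oblivious algebraic branching program (roABP) on $N$ variables in variable order $v_1<\cdots<v_N$ is a directed acyclic graph with vertex layers $V_0=\{s\},V_1,\ldots,V_N=\{t\}$, $|V_i|\le r$, edges only from $V_{i-1}$ to $V_i$, each edge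 from $V_{i-1}$ to $V_i$ labelled by a univariate polynomial in $v_i$; it computes the sum over all $s$–$t$ paths of the product of edge labels. Individual degree of a polynomial is its maximum degree in any single variable. An object is $t$-explicit if it can be constructed in $t$ steps in a model where field operations over $\mathbb{F}$ have unit cost. $\mathrm{poly}(\cdot)$ denotes a bound by a fixed polynomial in the arguments. *)

theory Defs
  imports "HOL-Library.Poly_Mapping" "HOL-Computational_Algebra.Polynomial"
begin

section \<open>Polynomials in the variables x, y, z\<close>

text \<open>The variables \<open>x\<^sub>1, \<dots>, x\<^sub>n\<close> and \<open>z\<^sub>1, \<dots>, z\<^sub>n\<close> are indexed from 0, as \<open>X i\<close> and \<open>Z i\<close>
  with \<open>i < n\<close>.\<close>

datatype ipsvar = X nat | Y | Z nat

type_synonym monomial = "ipsvar \<Rightarrow>\<^sub>0 nat"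
type_synonym 'a mpoly = "monomial \<Rightarrow>\<^sub>0 'a"

definition PConst :: "'a::zero \<Rightarrow> 'a mpoly" where
  "PConst c = Poly_Mapping.single 0 c"

definition PVar :: "ipsvar \<Rightarrow> 'a::zero_neq_one mpoly" where
  "PVar v = Poly_Mapping.single (Poly_Mapping.single v 1) 1"

definition pvars :: "'a::zero mpoly \<Rightarrow> ipsvar set" where
  "pvars p = (\<Union>m\<in>Poly_Mapping.keys p. Poly_Mapping.keys m)"

definition psubst :: "(ipsvar \<Rightarrow> 'a mpoly) \<Rightarrow> 'a::comm_ring_1 mpoly \<Rightarrow> 'a mpoly" where
  "psubst \<sigma> p = (\<Sum>m\<in>Poly_Mapping.keys p. PConst (Poly_Mapping.lookup p m) *
     (\<Prod>v\<in>Poly_Mapping.keys m. \<sigma> v ^ Poly_Mapping.lookup m v))"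

text \<open>The inserted 0 only serves to give constant polynomials individual degree 0.\<close>

definition individual_degree :: "'a::zero mpoly \<Rightarrow> nat" where
  "individual_degree p = Max (insert 0
     (\<Union>m\<in>Poly_Mapping.keys p. Poly_Mapping.lookup m ` Poly_Mapping.keys m))"

definition ips_vars :: "nat \<Rightarrow> ipsvar set" where
  "ips_vars n = X ` {..<n} \<union> {Y} \<union> Z ` {..<n}"

definition linear_in_yz :: "nat \<Rightarrow> 'a::zero mpoly \<Rightarrow> bool" where
  "linear_in_yz n C \<longleftrightarrow> (\<forall>m\<in>Poly_Mapping.keys C.
     Poly_Mapping.lookup m Y + (\<Sum>i<n. Poly_Mapping.lookup m (Z i)) \<le> 1)"

definition IPS_LIN_refutation :: "nat \<Rightarrow> 'a::comm_ring_1 mpoly \<Rightarrow> 'a mpoly \<Rightarrow> bool" where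
  "IPS_LIN_refutation n f C \<longleftrightarrow>
     pvars C \<subseteq> ips_vars n \<and>
     linear_in_yz n C \<and>
     psubst (\<lambda>v. case v of X i \<Rightarrow> PVar (X i) | Y \<Rightarrow> 0 | Z i \<Rightarrow> 0) C = 0 \<and>
     psubst (\<lambda>v. case v of X i \<Rightarrow> PVar (X i) | Y \<Rightarrow> f | Z i \<Rightarrow> PVar (X i) ^ 2 - PVar (X i)) C = 1"

definition subset_sum_poly :: "nat \<Rightarrow> (nat \<Rightarrow> 'a::comm_ring_1) \<Rightarrow> 'a \<Rightarrow> 'a mpoly" where
  "subset_sum_poly n \<alpha> \<beta> = (\<Sum>i<n. PConst (\<alpha> i) * PVar (X i)) - PConst \<beta>"

definition subset_sums :: "nat \<Rightarrow> (nat \<Rightarrow> 'a::comm_ring_1) \<Rightarrow> 'a set" where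
  "subset_sums n \<alpha> = {(\<Sum>i<n. \<alpha> i * x i) | x. \<forall>i<n. x i \<in> {0, 1}}"


section \<open>Read-once oblivious algebraic branching programs\<close>

text \<open>The vertices of layer \<open>i\<close> are named by numbers; equal names in different layers denote
  different vertices. \<open>edges B i\<close> and \<open>elabel B i\<close> concern the edges from layer \<open>i\<close> to layer
  \<open>Suc i\<close>. A variable order is the list \<open>vs\<close> of the variables, and the edges leaving layer \<open>i\<close>
  are labelled by univariate polynomials in \<open>vs ! i\<close>.\<close>

record (overloaded) 'a roabp =
  layer :: "nat \<Rightarrow> nat set"
  edges :: "nat \<Rightarrow> (nat \<times> nat) set"
  elabel :: "nat \<Rightarrow> nat \<times> nat \<Rightarrow> 'a poly"

definition is_roabp :: "nat \<Rightarrow> nat \<Rightarrow> 'a::zero roabp \<Rightarrow> bool" where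
  "is_roabp r N B \<longleftrightarrow>
     (\<exists>s. layer B 0 = {s}) \<and> (\<exists>t. layer B N = {t}) \<and>
     (\<forall>i\<le>N. finite (layer B i) \<and> card (layer B i) \<le> r) \<and>
     (\<forall>i<N. edges B i \<subseteq> layer B i \<times> layer B (Suc i))"

text \<open>In an roABP the first and the last layer are singletons, so these are the paths from
  \<open>s\<close> to \<open>t\<close>.\<close>

definition roabp_paths :: "nat \<Rightarrow> 'a::zero roabp \<Rightarrow> nat list set" where
  "roabp_paths N B = {p. length p = Suc N \<and> (\<forall>i\<le>N. p ! i \<in> layer B i) \<and>
     (\<forall>i<N. (p ! i, p ! Suc i) \<in> edges B i)}"

definition univariate_in :: "ipsvar \<Rightarrow> 'a::comm_ring_1 poly \<Rightarrow> 'a mpoly" where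
  "univariate_in v q = poly (map_poly PConst q) (PVar v)"

definition roabp_poly :: "ipsvar list \<Rightarrow> 'a::comm_ring_1 roabp \<Rightarrow> 'a mpoly" where
  "roabp_poly vs B = (\<Sum>p\<in>roabp_paths (length vs) B.
     \<Prod>i<length vs. univariate_in (vs ! i) (elabel B i (p ! i, p ! Suc i)))"

definition roabp_computes :: "nat \<Rightarrow> ipsvar list \<Rightarrow> 'a::comm_ring_1 roabp \<Rightarrow> 'a mpoly \<Rightarrow> bool" where
  "roabp_computes r vs B C \<longleftrightarrow> is_roabp r (length vs) B \<and> roabp_poly vs B = C"

definition variable_order :: "nat \<Rightarrow> ipsvar list \<Rightarrow> bool" where
  "variable_order n vs \<longleftrightarrow> distinct vs \<and> set vs = ips_vars n"


section \<open>Explicitness: a random access machine with unit-cost field operations\<close>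

text \<open>The memory of the machine consists of registers and arrays for natural numbers and of arrays
  for field elements. Constants, memory accesses, field operations, equality tests in the field,
  and addition, truncated subtraction and comparison of natural numbers cost one step each.
  Multiplication of natural numbers is deliberately not a primitive: at unit cost it would
  allow numbers of exponential length in polynomially many steps. Programs contain no field
  constants except 0 and 1, so they access the field only through their input.\<close>

datatype nexp =
    NConst nat
  | Reg nat
  | NGet nat nexp  \<comment> \<open>array name, index\<close>
  | NAdd nexp nexp
  | NSub nexp nexp

datatype fexp =
    FZero
  | FOne
  | FGet nat nexp  \<comment> \<open>array name, index\<close>
  | FAdd fexp fexp
  | FSub fexp fexp
  | FMul fexp fexp
  | FDiv fexp fexp

datatype bexp =
    NLess nexp nexp
  | FEq fexp fexp
  | BNot bexp
  | BAnd bexp bexp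

datatype com =
    Skip
  | SetReg nat nexp
  | NPut nat nexp nexp  \<comment> \<open>array name, index, value\<close>
  | FPut nat nexp fexp  \<comment> \<open>array name, index, value\<close>
  | Seq com com
  | Cond bexp com com
  | While bexp com

record 'a state =
  reg :: "nat \<Rightarrow> nat"
  narr :: "nat \<Rightarrow> nat \<Rightarrow> nat"
  farr :: "nat \<Rightarrow> nat \<Rightarrow> 'a"

fun nval :: "nexp \<Rightarrow> 'a state \<Rightarrow> nat" where
  "nval (NConst k) s = k"
| "nval (Reg x) s = reg s x"
| "nval (NGet a e) s = narr s a (nval e s)"
| "nval (NAdd e f) s = nval e s + nval f s"
| "nval (NSub e f) s = nval e s - nval f s"

fun fval :: "fexp \<Rightarrow> 'a::field state \<Rightarrow> 'a" where
  "fval FZero s = 0"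
| "fval FOne s = 1"
| "fval (FGet a e) s = farr s a (nval e s)"
| "fval (FAdd e f) s = fval e s + fval f s"
| "fval (FSub e f) s = fval e s - fval f s"
| "fval (FMul e f) s = fval e s * fval f s"
| "fval (FDiv e f) s = fval e s / fval f s"

fun bval :: "bexp \<Rightarrow> 'a::field state \<Rightarrow> bool" where
  "bval (NLess e f) s = (nval e s < nval f s)"
| "bval (FEq e f) s = (fval e s = fval f s)"
| "bval (BNot b) s = (\<not> bval b s)"
| "bval (BAnd b c) s = (bval b s \<and> bval c s)"

fun ncost :: "nexp \<Rightarrow> nat" where
  "ncost (NConst k) = 1"
| "ncost (Reg x) = 1"
| "ncost (NGet a e) = 1 + ncost e"
| "ncost (NAdd e f) = 1 + ncost e + ncost f"
| "ncost (NSub e f) = 1 + ncost e + ncost f"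

fun fcost :: "fexp \<Rightarrow> nat" where
  "fcost FZero = 1"
| "fcost FOne = 1"
| "fcost (FGet a e) = 1 + ncost e"
| "fcost (FAdd e f) = 1 + fcost e + fcost f"
| "fcost (FSub e f) = 1 + fcost e + fcost f"
| "fcost (FMul e f) = 1 + fcost e + fcost f"
| "fcost (FDiv e f) = 1 + fcost e + fcost f"

fun bcost :: "bexp \<Rightarrow> nat" where
  "bcost (NLess e f) = 1 + ncost e + ncost f"
| "bcost (FEq e f) = 1 + fcost e + fcost f"
| "bcost (BNot b) = 1 + bcost b"
| "bcost (BAnd b c) = 1 + bcost b + bcost c"

text \<open>\<open>exec c s k s'\<close>: started in state \<open>s\<close>, the program \<open>c\<close> halts in state \<open>s'\<close> after exactly \<open>k\<close> steps.\<close>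

inductive exec :: "com \<Rightarrow> 'a::field state \<Rightarrow> nat \<Rightarrow> 'a state \<Rightarrow> bool" where
  Skip: "exec Skip s 1 s"
| SetReg: "exec (SetReg x e) s (1 + ncost e) (s\<lparr>reg := (reg s)(x := nval e s)\<rparr>)"
| NPut: "exec (NPut a i e) s (1 + ncost i + ncost e)
    (s\<lparr>narr := (narr s)(a := (narr s a)(nval i s := nval e s))\<rparr>)"
| FPut: "exec (FPut a i e) s (1 + ncost i + fcost e)
    (s\<lparr>farr := (farr s)(a := (farr s a)(nval i s := fval e s))\<rparr>)"
| Seq: "exec c1 s k1 s1 \<Longrightarrow> exec c2 s1 k2 s2 \<Longrightarrow> exec (Seq c1 c2) s (k1 + k2) s2"
| CondTrue: "bval b s \<Longrightarrow> exec c1 s k s1 \<Longrightarrow> exec (Cond b c1 c2) s (1 + bcost b + k) s1"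
| CondFalse: "\<not> bval b s \<Longrightarrow> exec c2 s k s1 \<Longrightarrow> exec (Cond b c1 c2) s (1 + bcost b + k) s1"
| WhileFalse: "\<not> bval b s \<Longrightarrow> exec (While b c) s (1 + bcost b) s"
| WhileTrue: "bval b s \<Longrightarrow> exec c s k1 s1 \<Longrightarrow> exec (While b c) s1 k2 s2 \<Longrightarrow>
    exec (While b c) s (1 + bcost b + k1 + k2) s2"

fun var_code :: "nat \<Rightarrow> ipsvar \<Rightarrow> nat" where
  "var_code n (X i) = i"
| "var_code n Y = n"
| "var_code n (Z i) = n + 1 + i"

text \<open>Input: \<open>n\<close> in register 0, the variable order in number array 0, \<open>\<alpha>\<close> in field array 0, and
  \<open>\<beta>\<close> in field array 1 at index 0. All other memory is zero.\<close>

definition input_state :: "nat \<Rightarrow> (nat \<Rightarrow> 'a::field) \<Rightarrow> 'a \<Rightarrow> ipsvar list \<Rightarrow> 'a state" where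
  "input_state n \<alpha> \<beta> vs =
     \<lparr>reg = (\<lambda>x. if x = 0 then n else 0),
      narr = (\<lambda>a i. if a = 0 \<and> i < length vs then var_code n (vs ! i) else 0),
      farr = (\<lambda>a i. if a = 0 \<and> i < n then \<alpha> i else if a = 1 \<and> i = 0 then \<beta> else 0)\<rparr>"

text \<open>Output: an roABP as an edge list with sparse labels. Number array 1 holds the sizes of
  the vertex layers. For \<open>k\<close> less than register 1, item \<open>k\<close> is a monomial on an edge: its layer,
  source, target and exponent are in number arrays 2, 3, 4 and 5, and its coefficient is in field
  array 2. The label of an edge is the sum of all its monomials.\<close>

definition output_roabp :: "'a::field state \<Rightarrow> 'a roabp" where
  "output_roabp s =
     \<lparr>layer = (\<lambda>i. {..<narr s 1 i}),
      edges = (\<lambda>i. {(narr s 3 k, narr s 4 k) | k. k < reg s 1 \<and> narr s 2 k = i}),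
      elabel = (\<lambda>i e. \<Sum>k | k < reg s 1 \<and> narr s 2 k = i \<and> (narr s 3 k, narr s 4 k) = e.
                 monom (farr s 2 k) (narr s 5 k))\<rparr>"

text \<open>\<open>constructs_within P t n \<alpha> \<beta> vs B\<close>: on input \<open>n\<close>, \<open>\<alpha>\<close>, \<open>\<beta>\<close>, \<open>vs\<close>, the program \<open>P\<close> outputs the
  roABP \<open>B\<close> in at most \<open>t\<close> steps.\<close>

definition constructs_within ::
    "com \<Rightarrow> nat \<Rightarrow> nat \<Rightarrow> (nat \<Rightarrow> 'a::field) \<Rightarrow> 'a \<Rightarrow> ipsvar list \<Rightarrow> 'a roabp \<Rightarrow> bool" where
  "constructs_within P t n \<alpha> \<beta> vs B \<longleftrightarrow>
     (\<exists>k s. exec P (input_state n \<alpha> \<beta> vs) k s \<and> k \<le> t \<and> output_roabp s = B)"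

text \<open>The fixed polynomial standing for \<open>poly(a, n)\<close>. It has to be independent of the field, but
  HOL cannot quantify over types inside a formula, so an existential quantifier for it would
  have to be placed under a fixed field. It is therefore given concretely.\<close>

definition poly_bound :: "nat \<Rightarrow> nat \<Rightarrow> nat" where
  "poly_bound a n = (a + n + 2) ^ 20"

end

theory Submission
  imports Defs
begin

text \<open>Let \<open>f = \<Sum> \<alpha>\<^sub>i x\<^sub>i - \<beta>\<close> and let \<open>g\<close> be the multilinear polynomial that agrees with \<open>1/f\<close> on the
  cube. Since \<open>g\<close> is linear in \<open>x\<^sub>i\<close>, the polynomial \<open>x\<^sub>i g - (x\<^sub>i\<^sup>2 - x\<^sub>i) \<partial>\<^sub>i g\<close> is multilinear, so
  \<open>g f - \<Sum> \<alpha>\<^sub>i (x\<^sub>i\<^sup>2 - x\<^sub>i) \<partial>\<^sub>i g\<close> is the multilinear polynomial that equals 1 on the cube, namely 1.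
  Hence \<open>C = g y - \<Sum> \<alpha>\<^sub>i (\<partial>\<^sub>i g) z\<^sub>i\<close> is a refutation, even of individual degree 1. An roABP
  can evaluate each of these \<open>n + 1\<close> summands in any order by remembering the sum of the \<open>\<alpha>\<^sub>i\<close> with
  \<open>x\<^sub>i = 1\<close> read so far: partial sums are themselves subset sums, so there are at most \<open>|A|\<close> of them.\<close>

section \<open>Substitution in polynomials\<close>

text \<open>The refutation identity is verified separately at each point \<open>B\<close> of the
  cube. Let chi_B be the product of the x_k with k in B and of the 1 - x_k with k not in B, so that
  g is the sum of all chi_B / (\<alpha>(B) - \<beta>). Passing from chi_B to -\<alpha>_i times its
  derivative in x_i only replaces the factor at x_i by -\<alpha>_i or \<alpha>_i. Adding the z_i
  terms turns f chi_B into (\<alpha>(B) - \<beta>) chi_B, which cancels the denominator, and the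
  chi_B add up to 1. One polynomial must serve all variable orders, so it is defined as an
  order-free sum over subsets. Reading the variables in any order unfolds this sum: a variable in
  the subset moves the partial sum, any other leaves it. The n + 1 summands run in parallel as
  branches; a vertex is a pair of partial sum and branch, whence the width |A| (n + 1). A program
  cannot enumerate the cube to find the partial sums. It grows a list of them from layer to layer,
  searching for each shifted sum and appending it if new; indices once assigned stay valid.\<close>

lemma PConst_0 [simp]: "PConst 0 = 0"
  by (simp add: PConst_def)

lemma PConst_1 [simp]: "PConst 1 = 1"
  by (simp add: PConst_def)

lemma PConst_add: "PConst (a + b :: 'a::comm_ring_1) = PConst a + PConst b"
  by (simp add: PConst_def single_add)

lemma PConst_uminus: "PConst (- a :: 'a::comm_ring_1) = - PConst a"
  by (simp add: PConst_def single_uminus)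

lemma PConst_diff: "PConst (a - b :: 'a::comm_ring_1) = PConst a - PConst b"
  by (simp add: PConst_def single_diff)

lemma PConst_mult: "PConst (a * b :: 'a::comm_ring_1) = PConst a * PConst b"
  by (simp add: PConst_def mult_single)

lemma PConst_sum: "PConst (sum f A :: 'a::comm_ring_1) = (\<Sum>x\<in>A. PConst (f x))"
  by (induction A rule: infinite_finite_induct) (simp_all add: PConst_add)

lemma sum_singles:
  fixes p :: "'a::comm_ring_1 mpoly"
  shows "p = (\<Sum>m\<in>Poly_Mapping.keys p. Poly_Mapping.single m (Poly_Mapping.lookup p m))"
  by (rule poly_mapping_eqI)
     (simp add: lookup_sum lookup_single when_def in_keys_iff)

definition mono_subst :: "(ipsvar \<Rightarrow> 'a::comm_ring_1 mpoly) \<Rightarrow> monomial \<Rightarrow> 'a mpoly" where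
  "mono_subst \<sigma> m = (\<Prod>v\<in>Poly_Mapping.keys m. \<sigma> v ^ Poly_Mapping.lookup m v)"

text \<open>Indices outside \<open>keys\<close> have exponent 0 and contribute the factor 1, so all
  three products can be taken over \<open>?K\<close>, where exponents add.\<close>

lemma mono_subst_add: "mono_subst \<sigma> (m + m') = mono_subst \<sigma> m * mono_subst \<sigma> m'"
proof -
  let ?K = "Poly_Mapping.keys m \<union> Poly_Mapping.keys m'"
  have *: "mono_subst \<sigma> k = (\<Prod>v\<in>?K. \<sigma> v ^ Poly_Mapping.lookup k v)"
    if "Poly_Mapping.keys k \<subseteq> ?K" for k
    unfolding mono_subst_def using that
    by (intro prod.mono_neutral_left) (auto simp: in_keys_iff)
  show ?thesis
    using *[of "m + m'"] *[of m] *[of m'] keys_add[of m m']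
    by (simp add: lookup_add power_add prod.distrib)
qed

text \<open>Monomials may cancel in \<open>p + q\<close>; this is harmless, as a coefficient 0
  contributes 0.\<close>

lemma psubst_add: "psubst \<sigma> (p + q) = psubst \<sigma> p + psubst \<sigma> q"
  unfolding psubst_def
  by (rule setsum_keys_plus_distrib) (simp_all add: PConst_add distrib_right)

lemma psubst_0: "psubst \<sigma> 0 = 0"
  by (simp add: psubst_def)

lemma psubst_sum: "psubst \<sigma> (sum f A) = (\<Sum>x\<in>A. psubst \<sigma> (f x))"
  by (induction A rule: infinite_finite_induct) (simp_all add: psubst_add psubst_0)

lemma psubst_single: "psubst \<sigma> (Poly_Mapping.single m c) = PConst c * mono_subst \<sigma> m"
  by (cases "c = 0") (simp_all add: psubst_def mono_subst_def)

text \<open>Both sides are bilinear, which reduces the claim to single monomials and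
  \<open>mono_subst_add\<close>.\<close>

lemma psubst_mult: "psubst \<sigma> (p * q) = psubst \<sigma> p * psubst \<sigma> q"
proof -
  let ?t = "\<lambda>p m. Poly_Mapping.single m (Poly_Mapping.lookup p m)"
  let ?P = "Poly_Mapping.keys p" and ?Q = "Poly_Mapping.keys q"
  have "psubst \<sigma> (p * q) = psubst \<sigma> ((\<Sum>m\<in>?P. ?t p m) * (\<Sum>m\<in>?Q. ?t q m))"
    using sum_singles[of p] sum_singles[of q] by simp
  also have "\<dots> = (\<Sum>m\<in>?P. \<Sum>m'\<in>?Q. psubst \<sigma> (?t p m) * psubst \<sigma> (?t q m'))"
    by (simp add: sum_product psubst_sum mult_single psubst_single PConst_mult mono_subst_add mult_ac)
  also have "\<dots> = psubst \<sigma> (\<Sum>m\<in>?P. ?t p m) * psubst \<sigma> (\<Sum>m\<in>?Q. ?t q m)"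
    by (simp add: sum_product psubst_sum)
  finally show ?thesis
    using sum_singles[of p] sum_singles[of q] by simp
qed

lemma psubst_PConst: "psubst \<sigma> (PConst c) = PConst c"
  by (simp add: PConst_def[of c] psubst_single) (simp add: PConst_def mono_subst_def)

lemma psubst_PVar: "psubst \<sigma> (PVar v) = \<sigma> v"
  by (simp add: PVar_def psubst_single mono_subst_def)

lemma psubst_prod: "psubst \<sigma> (prod f A) = (\<Prod>x\<in>A. psubst \<sigma> (f x))"
  using psubst_PConst[of \<sigma> 1]
  by (induction A rule: infinite_finite_induct) (simp_all add: psubst_mult)

lemma poly_map_poly_PConst_pCons:
  "poly (map_poly PConst (pCons c q)) x = PConst c + x * poly (map_poly PConst q) x"
  by (simp add: map_poly_pCons)

lemma psubst_univariate_in: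
  "psubst \<sigma> (univariate_in v q) = poly (map_poly PConst q) (\<sigma> v)"
  unfolding univariate_in_def
  by (induction q)
     (simp_all add: poly_map_poly_PConst_pCons psubst_0 psubst_add psubst_mult psubst_PConst psubst_PVar)

section \<open>Multilinear polynomials\<close>

text \<open>One predicate yields three properties of the certificate: its variables, its individual
  degree and, with a suitable \<open>S\<close>, its linearity in y and z.\<close>

definition multilinear_in :: "ipsvar set \<Rightarrow> 'a::comm_ring_1 mpoly \<Rightarrow> bool" where
  "multilinear_in S p \<longleftrightarrow> (\<forall>m\<in>Poly_Mapping.keys p.
     Poly_Mapping.keys m \<subseteq> S \<and> (\<forall>v. Poly_Mapping.lookup m v \<le> 1))"

lemma multilinear_in_PConst: "multilinear_in S (PConst c)"
  by (auto simp: multilinear_in_def PConst_def split: if_splits)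

lemma multilinear_in_PVar: "v \<in> S \<Longrightarrow> multilinear_in S (PVar v)"
  by (auto simp: multilinear_in_def PVar_def lookup_single when_def)

lemma multilinear_in_add:
  "multilinear_in S p \<Longrightarrow> multilinear_in S q \<Longrightarrow> multilinear_in S (p + q)"
  using keys_add[of p q] unfolding multilinear_in_def by blast

lemma multilinear_in_sum:
  "(\<And>x. x \<in> A \<Longrightarrow> multilinear_in S (f x)) \<Longrightarrow> multilinear_in S (sum f A)"
proof (induction A rule: infinite_finite_induct)
  case (insert x F)
  then show ?case by (simp add: multilinear_in_add)
qed (use multilinear_in_PConst[of S 0] in simp_all)

text \<open>By disjointness each variable occurs in at most one factor of a monomial, so exponents
  never add up to 2.\<close>

lemma multilinear_in_mult:
  assumes "multilinear_in S p" "multilinear_in T q" "S \<inter> T = {}"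
  shows "multilinear_in (S \<union> T) (p * q)"
  unfolding multilinear_in_def
proof
  fix m assume "m \<in> Poly_Mapping.keys (p * q)"
  then obtain k l where m: "m = k + l" and k: "k \<in> Poly_Mapping.keys p" and l: "l \<in> Poly_Mapping.keys q"
    using keys_mult[of p q] by blast
  have 1: "Poly_Mapping.keys k \<subseteq> S" "Poly_Mapping.keys l \<subseteq> T"
    "\<And>v. Poly_Mapping.lookup k v \<le> 1" "\<And>v. Poly_Mapping.lookup l v \<le> 1"
    using assms k l by (auto simp: multilinear_in_def)
  have "Poly_Mapping.lookup k v = 0 \<or> Poly_Mapping.lookup l v = 0" for v
    using 1(1,2) assms(3) in_keys_iff by (metis disjoint_iff subsetD)
  then have "Poly_Mapping.lookup m v \<le> 1" for v
    using 1(3,4)[of v] by (metis m lookup_add add_0 add_0_right)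
  moreover have "Poly_Mapping.keys m \<subseteq> S \<union> T"
    using 1(1,2) keys_add[of k l] m by blast
  ultimately show "Poly_Mapping.keys m \<subseteq> S \<union> T \<and> (\<forall>v. Poly_Mapping.lookup m v \<le> 1)"
    by blast
qed

text \<open>Intersecting with \<open>S\<close> records that the factor at a \<open>v\<close> outside
  \<open>S\<close> is constant; a product over all variables then involves only those in
  \<open>S\<close>.\<close>

lemma multilinear_in_prod:
  assumes "finite A" "\<And>v. v \<in> A \<Longrightarrow> multilinear_in ({v} \<inter> S) (f v)"
  shows "multilinear_in (A \<inter> S) (prod f A)"
  using assms
proof (induction A)
  case empty
  then show ?case using multilinear_in_PConst[of "{}" 1] by simp
next
  case (insert v A)
  then have "multilinear_in (({v} \<inter> S) \<union> (A \<inter> S)) (f v * prod f A)"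
    by (intro multilinear_in_mult) auto
  then show ?case
    using insert.hyps by (simp add: Int_insert_left split: if_splits)
qed

lemma multilinear_in_mono: "multilinear_in S p \<Longrightarrow> S \<subseteq> T \<Longrightarrow> multilinear_in T p"
  unfolding multilinear_in_def by blast

text \<open>A label with \<open>b = 0\<close> is constant and must not count as an occurrence of
  \<open>v\<close>; this removes from a branch the y and z of all others.\<close>

lemma multilinear_in_linear:
  assumes "[:a, b:] = q" "b \<noteq> 0 \<Longrightarrow> v \<in> S"
  shows "multilinear_in ({v} \<inter> S) (univariate_in v q)"
proof (cases "b = 0")
  case True
  then show ?thesis
    by (simp add: assms(1)[symmetric] univariate_in_def poly_map_poly_PConst_pCons multilinear_in_PConst)
next
  case False
  then have "multilinear_in ({} \<union> {v}) (PConst b * PVar v)"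
    by (intro multilinear_in_mult multilinear_in_PConst multilinear_in_PVar) auto
  with False assms(2) show ?thesis
    by (simp add: assms(1)[symmetric] univariate_in_def poly_map_poly_PConst_pCons
        multilinear_in_PConst multilinear_in_add mult.commute)
qed

section \<open>The refutation\<close>

text \<open>Branch \<open>0\<close> collects the terms divisible by \<open>y\<close>, branch \<open>Suc i\<close> those divisible by
  \<open>z\<^sub>i\<close>. In branch \<open>Suc i\<close> the labels at \<open>x\<^sub>i\<close> turn the interpolation of \<open>1/f\<close> into \<open>-\<alpha>\<^sub>i\<close> times
  its partial derivative with respect to \<open>x\<^sub>i\<close>.\<close>

fun branch :: "ipsvar \<Rightarrow> nat" where
  "branch (X i) = Suc i"
| "branch Y = 0"
| "branch (Z i) = Suc i"

fun addend :: "(nat \<Rightarrow> 'a::zero) \<Rightarrow> ipsvar \<Rightarrow> 'a" where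
  "addend \<alpha> (X i) = \<alpha> i"
| "addend \<alpha> Y = 0"
| "addend \<alpha> (Z i) = 0"

text \<open>For \<open>j = Suc i\<close> the factor 1 - x_i of the cube indicator becomes
  -\<alpha>_i times its derivative -1. A y or z is a factor of its own branch only.\<close>

fun stay :: "(nat \<Rightarrow> 'a::comm_ring_1) \<Rightarrow> nat \<Rightarrow> ipsvar \<Rightarrow> 'a poly" where
  "stay \<alpha> j (X i) = (if j = Suc i then [:\<alpha> i:] else [:1, -1:])"
| "stay \<alpha> j v = (if j = branch v then [:0, 1:] else 1)"

text \<open>The label 0 lets y and z face the same choice between staying and moving as the x
  variables, while every subset containing one of them contributes nothing.\<close>

fun move :: "(nat \<Rightarrow> 'a::comm_ring_1) \<Rightarrow> nat \<Rightarrow> ipsvar \<Rightarrow> 'a poly" where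
  "move \<alpha> j (X i) = (if j = Suc i then [:- \<alpha> i:] else [:0, 1:])"
| "move \<alpha> j v = 0"

text \<open>The set \<open>B\<close> collects the variables that move. It ranges over subsets of all
  variables so that it matches the choices along a path in any order.\<close>

definition certificate :: "nat \<Rightarrow> (nat \<Rightarrow> 'a::field) \<Rightarrow> 'a \<Rightarrow> 'a mpoly" where
  "certificate n \<alpha> \<beta> = (\<Sum>j\<le>n. \<Sum>B\<in>Pow (ips_vars n). PConst (1 / (sum (addend \<alpha>) B - \<beta>)) *
     ((\<Prod>v\<in>B. univariate_in v (move \<alpha> j v)) * (\<Prod>v\<in>ips_vars n - B. univariate_in v (stay \<alpha> j v))))"

lemma finite_ips_vars [simp]: "finite (ips_vars n)"
  by (simp add: ips_vars_def)

text \<open>At most one variable among y and the z belongs to branch \<open>j\<close>, the others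
  having label 1; this support bound is the source of linearity in y and z.\<close>

lemma certificate_multilinear_terms:
  assumes "B \<subseteq> ips_vars n"
  shows "multilinear_in (ips_vars n \<inter> (range X \<union> {v. branch v = j}))
     (PConst c * ((\<Prod>v\<in>B. univariate_in v (move \<alpha> j v)) * (\<Prod>v\<in>ips_vars n - B. univariate_in v (stay \<alpha> j v))))"
proof -
  let ?S = "range X \<union> {v. branch v = j}"
  have m: "multilinear_in ({v} \<inter> ?S) (univariate_in v (move \<alpha> j v))" for v
    by (rule multilinear_in_linear[of "coeff (move \<alpha> j v) 0" "coeff (move \<alpha> j v) 1"]; cases v) auto
  have s: "multilinear_in ({v} \<inter> ?S) (univariate_in v (stay \<alpha> j v))" for v
    by (rule multilinear_in_linear[of "coeff (stay \<alpha> j v) 0" "coeff (stay \<alpha> j v) 1"]; cases v)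
       (auto simp: one_pCons)
  have fin: "finite B" using finite_subset[OF assms finite_ips_vars] .
  \<comment> \<open>The leading \<open>{}\<close> is the support of the constant factor, so that
    \<open>multilinear_in_mult\<close> applies to it too.\<close>
  have "multilinear_in ({} \<union> ((B \<inter> ?S) \<union> ((ips_vars n - B) \<inter> ?S)))
     (PConst c * ((\<Prod>v\<in>B. univariate_in v (move \<alpha> j v)) * (\<Prod>v\<in>ips_vars n - B. univariate_in v (stay \<alpha> j v))))"
    by (intro multilinear_in_mult multilinear_in_PConst multilinear_in_prod m s)
       (use fin in auto)
  then show ?thesis
    by (rule multilinear_in_mono) (use assms in auto)
qed

lemma certificate_multilinear: "multilinear_in (ips_vars n) (certificate n \<alpha> \<beta>)"
  unfolding certificate_def
  by (intro multilinear_in_sum multilinear_in_mono[OF certificate_multilinear_terms]) auto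

lemma pvars_certificate: "pvars (certificate n \<alpha> \<beta>) \<subseteq> ips_vars n"
  using certificate_multilinear[of n \<alpha> \<beta>] by (auto simp: multilinear_in_def pvars_def)

lemma individual_degree_certificate: "individual_degree (certificate n \<alpha> \<beta>) \<le> 1"
  using certificate_multilinear[of n \<alpha> \<beta>]
  by (auto simp: multilinear_in_def individual_degree_def)

lemma linear_certificate: "linear_in_yz n (certificate n \<alpha> \<beta>)"
  unfolding linear_in_yz_def
proof
  let ?g = "\<lambda>j. \<Sum>B\<in>Pow (ips_vars n). PConst (1 / (sum (addend \<alpha>) B - \<beta>)) *
     ((\<Prod>v\<in>B. univariate_in v (move \<alpha> j v)) * (\<Prod>v\<in>ips_vars n - B. univariate_in v (stay \<alpha> j v)))"
  fix m assume "m \<in> Poly_Mapping.keys (certificate n \<alpha> \<beta>)"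
  \<comment> \<open>A monomial of the sum already occurs in a single branch, where only one of y and
    the z is available.\<close>
  then have "m \<in> (\<Union>j\<in>{..n}. Poly_Mapping.keys (?g j))"
    unfolding certificate_def by (rule subsetD[OF keys_sum])
  then obtain j where "m \<in> Poly_Mapping.keys (?g j)"
    by (rule UN_E)
  moreover have "multilinear_in (range X \<union> {v. branch v = j}) (?g j)"
    by (intro multilinear_in_sum multilinear_in_mono[OF certificate_multilinear_terms]) auto
  ultimately have m: "Poly_Mapping.keys m \<subseteq> range X \<union> {v. branch v = j}" "\<And>v. Poly_Mapping.lookup m v \<le> 1"
    by (auto simp: multilinear_in_def)
  have le: "Poly_Mapping.lookup m v \<le> (if branch v = j then 1 else 0)" if "v \<notin> range X" for v
  proof (cases "branch v = j")
    case False
    with m(1) that have "v \<notin> Poly_Mapping.keys m" by auto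
    then show ?thesis by (simp add: in_keys_iff)
  qed (use m in auto)
  have "Y \<notin> range X" and "Z i \<notin> range X" for i by auto
  note leY = le[OF this(1)] and leZ = le[OF this(2)]
  have "(\<Sum>i<n. Poly_Mapping.lookup m (Z i)) \<le> (\<Sum>i<n. if Suc i = j then 1 else 0)"
    by (rule sum_mono) (use leZ in simp)
  also have "\<dots> \<le> (if j = 0 then 0 else 1)"
    by (cases j) auto
  finally show "Poly_Mapping.lookup m Y + (\<Sum>i<n. Poly_Mapping.lookup m (Z i)) \<le> 1"
    using leY by (cases j) auto
qed

text \<open>Both substitutions demanded of a refutation are instances of this general
  \<open>\<sigma>\<close>. Subsets containing y or some z vanish because \<open>move\<close> is 0
  there.\<close>

lemma psubst_certificate:
  fixes \<sigma> :: "ipsvar \<Rightarrow> 'a::field mpoly"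
  defines "x \<equiv> \<lambda>i. \<sigma> (X i)"
  shows "psubst \<sigma> (certificate n \<alpha> \<beta>) =
    (\<Sum>B\<in>Pow {..<n}. PConst (1 / (sum \<alpha> B - \<beta>)) *
      (\<sigma> Y * ((\<Prod>k\<in>B. x k) * (\<Prod>k\<in>{..<n} - B. 1 - x k)) +
       (\<Sum>i<n. \<sigma> (Z i) * ((\<Prod>k\<in>B. if k = i then - PConst (\<alpha> i) else x k) *
          (\<Prod>k\<in>{..<n} - B. if k = i then PConst (\<alpha> i) else 1 - x k)))))"
proof -
  let ?ev = "\<lambda>v q. poly (map_poly PConst q) (\<sigma> v)"
  let ?XS = "X ` {..<n}" and ?YZ = "insert Y (Z ` {..<n})"
  have V: "ips_vars n = ?XS \<union> ?YZ" by (auto simp: ips_vars_def)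
  have Xs: "?ev (X k) (stay \<alpha> j (X k)) = (if Suc k = j then PConst (\<alpha> k) else 1 - x k)" for j k
    by (simp add: poly_map_poly_PConst_pCons x_def PConst_uminus)
  have Xm: "?ev (X k) (move \<alpha> j (X k)) = (if Suc k = j then - PConst (\<alpha> k) else x k)" for j k
    by (simp add: poly_map_poly_PConst_pCons x_def PConst_uminus)
  let ?z = "\<lambda>j. case j of 0 \<Rightarrow> \<sigma> Y | Suc i \<Rightarrow> \<sigma> (Z i)"
  have Zs: "?ev v (stay \<alpha> j v) = (if branch v = j then ?z j else 1)" if "v \<in> ?YZ" for j v
    using that by (auto simp: poly_map_poly_PConst_pCons one_pCons)
  \<comment> \<open>Only the variable belonging to branch \<open>j\<close> has a label other than 1,
    and \<open>j \<le> n\<close> ensures that it exists.\<close>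
  have YZ: "(\<Prod>v\<in>?YZ. ?ev v (stay \<alpha> j v)) = ?z j" if "j \<le> n" for j
  proof -
    have "(\<Prod>v\<in>?YZ. ?ev v (stay \<alpha> j v)) = (\<Prod>v\<in>?YZ. if branch v = j then ?z j else 1)"
      by (rule prod.cong) (use Zs in auto)
    also have "\<dots> = (\<Prod>v\<in>{case j of 0 \<Rightarrow> Y | Suc i \<Rightarrow> Z i}. if branch v = j then ?z j else 1)"
    proof (rule prod.mono_neutral_right)
      show "{case j of 0 \<Rightarrow> Y | Suc i \<Rightarrow> Z i} \<subseteq> ?YZ"
        using that by (cases j) auto
      show "\<forall>v\<in>?YZ - {case j of 0 \<Rightarrow> Y | Suc i \<Rightarrow> Z i}. (if branch v = j then ?z j else 1) = 1"
        by (cases j) auto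
    qed auto
    also have "\<dots> = ?z j" by (cases j) auto
    finally show ?thesis .
  qed
  let ?T = "\<lambda>j B. PConst (1 / (sum \<alpha> B - \<beta>)) *
      (?z j * ((\<Prod>k\<in>B. if Suc k = j then - PConst (\<alpha> k) else x k) *
          (\<Prod>k\<in>{..<n} - B. if Suc k = j then PConst (\<alpha> k) else 1 - x k)))"
  have inner: "(\<Sum>B\<in>Pow (ips_vars n). PConst (1 / (sum (addend \<alpha>) B - \<beta>)) *
     ((\<Prod>v\<in>B. ?ev v (move \<alpha> j v)) * (\<Prod>v\<in>ips_vars n - B. ?ev v (stay \<alpha> j v)))) =
     (\<Sum>B\<in>Pow {..<n}. ?T j B)" (is "sum ?f _ = _") if j: "j \<le> n" for j
  proof -
    have "sum ?f (Pow (ips_vars n)) = sum ?f (Pow ?XS)"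
    proof (rule sum.mono_neutral_right)
      show "\<forall>B\<in>Pow (ips_vars n) - Pow ?XS. ?f B = 0"
      proof
        fix B assume B: "B \<in> Pow (ips_vars n) - Pow ?XS"
        then obtain v where v: "v \<in> B" "v \<notin> ?XS" "v \<in> ?YZ" using V by blast
        have "finite B" using B finite_subset[OF _ finite_ips_vars] by blast
        then have "(\<Prod>v\<in>B. ?ev v (move \<alpha> j v)) = 0"
          using v by (intro prod_zero bexI[of _ v]) auto
        then show "?f B = 0" by simp
      qed
    qed (use V in auto)
    also have "\<dots> = sum ?f ((`) X ` Pow {..<n})"
      by (simp add: image_Pow_surj)
    also have "\<dots> = (\<Sum>B\<in>Pow {..<n}. ?f (X ` B))"
      by (subst sum.reindex) (auto intro!: inj_on_image_Pow simp: inj_on_def)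
    also have "\<dots> = (\<Sum>B\<in>Pow {..<n}. ?T j B)"
    proof (rule sum.cong[OF refl])
      fix B assume B: "B \<in> Pow {..<n}"
      have inj: "inj_on X A" for A by (auto simp: inj_on_def)
      have "ips_vars n - X ` B = X ` ({..<n} - B) \<union> ?YZ" using V B by auto
      moreover have "(\<Prod>v\<in>X ` ({..<n} - B) \<union> ?YZ. ?ev v (stay \<alpha> j v)) =
          (\<Prod>v\<in>X ` ({..<n} - B). ?ev v (stay \<alpha> j v)) * (\<Prod>v\<in>?YZ. ?ev v (stay \<alpha> j v))"
        by (rule prod.union_disjoint) auto
      ultimately show "?f (X ` B) = ?T j B"
        by (simp only: YZ[OF j] prod.reindex[OF inj] sum.reindex[OF inj] o_def Xs Xm addend.simps)
           (simp add: mult_ac)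
    qed
    finally show ?thesis .
  qed
  have "psubst \<sigma> (certificate n \<alpha> \<beta>) = (\<Sum>j\<le>n. \<Sum>B\<in>Pow (ips_vars n). PConst (1 / (sum (addend \<alpha>) B - \<beta>)) *
     ((\<Prod>v\<in>B. ?ev v (move \<alpha> j v)) * (\<Prod>v\<in>ips_vars n - B. ?ev v (stay \<alpha> j v))))"
    unfolding certificate_def
    by (simp only: psubst_sum psubst_mult psubst_prod psubst_univariate_in psubst_PConst)
  also have "\<dots> = (\<Sum>j\<le>n. \<Sum>B\<in>Pow {..<n}. ?T j B)"
    using inner by simp
  also have "\<dots> = (\<Sum>B\<in>Pow {..<n}. \<Sum>j\<le>n. ?T j B)"
    by (rule sum.swap)
  also have "\<dots> = (\<Sum>B\<in>Pow {..<n}. ?T 0 B + (\<Sum>i<n. ?T (Suc i) B))"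
    by (simp only: sum.atMost_shift)
  finally show ?thesis
    by (simp add: distrib_left sum_distrib_left mult.assoc cong: if_cong)
qed

text \<open>Let R be the product of the factors away from \<open>i\<close>. For \<open>i\<close> in
  \<open>B\<close> the indicator is x_i R and the left side is c_i (1 - x_i) times it; otherwise the
  indicator is (1 - x_i) R and the left side is -c_i x_i times it.\<close>

lemma interpolation_term:
  fixes x c :: "nat \<Rightarrow> 'r::comm_ring_1"
  assumes "B \<subseteq> {..<n}" "i < n"
  shows "(x i ^ 2 - x i) * ((\<Prod>k\<in>B. if k = i then - c i else x k) *
          (\<Prod>k\<in>{..<n} - B. if k = i then c i else 1 - x k)) =
     (if i \<in> B then c i else 0) * ((\<Prod>k\<in>B. x k) * (\<Prod>k\<in>{..<n} - B. 1 - x k))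
     - c i * x i * ((\<Prod>k\<in>B. x k) * (\<Prod>k\<in>{..<n} - B. 1 - x k))"
proof -
  have fin: "finite B" "finite ({..<n} - B)" using assms finite_subset by auto
  have *: "(\<Prod>k\<in>A. if k = i then d else g k) = (if i \<in> A then d * prod g (A - {i}) else prod g A)"
    if "finite A" for A d and g :: "nat \<Rightarrow> 'r"
  proof (cases "i \<in> A")
    case True
    have "(\<Prod>k\<in>A - {i}. if k = i then d else g k) = prod g (A - {i})"
      by (rule prod.cong) auto
    then show ?thesis using prod.remove[OF that True, of "\<lambda>k. if k = i then d else g k"] True by simp
  qed (auto intro: prod.cong)
  show ?thesis
  proof (cases "i \<in> B")
    case True
    then show ?thesis
      using prod.remove[OF fin(1) True, of x]
      by (simp add: *[OF fin(1)] *[OF fin(2)] algebra_simps power2_eq_square)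
  next
    case False
    then have "i \<in> {..<n} - B" using assms by auto
    with False show ?thesis
      by (simp add: *[OF fin(1)] *[OF fin(2)] algebra_simps power2_eq_square
          prod.remove[OF fin(2) \<open>i \<in> {..<n} - B\<close>, of "\<lambda>k. 1 - x k"])
  qed
qed

lemma sum_in_subset_sums:
  assumes "B \<subseteq> {..<n}"
  shows "sum \<alpha> B \<in> subset_sums n \<alpha>"
proof -
  have "sum \<alpha> B = (\<Sum>i<n. \<alpha> i * of_bool (i \<in> B))"
  proof -
    have "(\<Sum>i<n. \<alpha> i * of_bool (i \<in> B)) = (\<Sum>i<n. if i \<in> B then \<alpha> i else 0)"
      by (rule sum.cong) auto
    then show ?thesis
      using assms by (simp add: sum.inter_restrict[symmetric] inf.absorb2)
  qed
  then show ?thesis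
    unfolding subset_sums_def by fastforce
qed

lemma certificate_refutes:
  fixes \<alpha> :: "nat \<Rightarrow> 'a::field"
  assumes "\<beta> \<notin> subset_sums n \<alpha>"
  shows "IPS_LIN_refutation n (subset_sum_poly n \<alpha> \<beta>) (certificate n \<alpha> \<beta>)"
proof -
  let ?x = "\<lambda>i. PVar (X i) :: 'a mpoly" and ?c = "\<lambda>i. PConst (\<alpha> i)"
  let ?f = "subset_sum_poly n \<alpha> \<beta>"
  let ?chi = "\<lambda>B. (\<Prod>k\<in>B. ?x k) * (\<Prod>k\<in>{..<n} - B. 1 - ?x k)"
  have "psubst (\<lambda>v. case v of X i \<Rightarrow> ?x i | Y \<Rightarrow> ?f | Z i \<Rightarrow> ?x i ^ 2 - ?x i) (certificate n \<alpha> \<beta>)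
    = (\<Sum>B\<in>Pow {..<n}. PConst (1 / (sum \<alpha> B - \<beta>)) *
      (?f * ?chi B +
       (\<Sum>i<n. (?x i ^ 2 - ?x i) * ((\<Prod>k\<in>B. if k = i then - ?c i else ?x k) *
          (\<Prod>k\<in>{..<n} - B. if k = i then ?c i else 1 - ?x k)))))"
    by (simp add: psubst_certificate cong: if_cong)
  also have "\<dots> = (\<Sum>B\<in>Pow {..<n}. ?chi B)"
  proof (rule sum.cong[OF refl])
    fix B assume "B \<in> Pow {..<n}"
    then have B: "B \<subseteq> {..<n}" by simp
    then have ne: "sum \<alpha> B \<noteq> \<beta>" using sum_in_subset_sums assms by metis
    have "(\<Sum>i<n. (?x i ^ 2 - ?x i) * ((\<Prod>k\<in>B. if k = i then - ?c i else ?x k) *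
          (\<Prod>k\<in>{..<n} - B. if k = i then ?c i else 1 - ?x k)))
      = (\<Sum>i<n. (if i \<in> B then ?c i else 0) * ?chi B - ?c i * ?x i * ?chi B)"
      by (rule sum.cong[OF refl], rule interpolation_term[OF B]) simp
    also have "\<dots> = PConst (sum \<alpha> B) * ?chi B - (\<Sum>i<n. ?c i * ?x i) * ?chi B"
      using B by (simp add: sum_subtractf sum_distrib_right[symmetric] PConst_sum
          sum.inter_restrict[symmetric] inf.absorb2)
    \<comment> \<open>The linear form in \<open>?f\<close> cancels against that of the z terms and
      leaves the constant \<open>sum \<alpha> B - \<beta>\<close>, the inverse of the interpolation
      weight.\<close>
    finally have "PConst (1 / (sum \<alpha> B - \<beta>)) *
      (?f * ?chi B +
       (\<Sum>i<n. (?x i ^ 2 - ?x i) * ((\<Prod>k\<in>B. if k = i then - ?c i else ?x k) *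
          (\<Prod>k\<in>{..<n} - B. if k = i then ?c i else 1 - ?x k)))) =
       PConst (1 / (sum \<alpha> B - \<beta>)) * PConst (sum \<alpha> B - \<beta>) * ?chi B"
      by (simp add: subset_sum_poly_def PConst_diff algebra_simps)
    also have "\<dots> = ?chi B"
      using ne by (simp flip: PConst_mult)
    finally show "PConst (1 / (sum \<alpha> B - \<beta>)) *
      (?f * ?chi B +
       (\<Sum>i<n. (?x i ^ 2 - ?x i) * ((\<Prod>k\<in>B. if k = i then - ?c i else ?x k) *
          (\<Prod>k\<in>{..<n} - B. if k = i then ?c i else 1 - ?x k)))) = ?chi B" .
  qed
  \<comment> \<open>Expanding the product picks one of two summands at each \<open>k\<close>, that
    is, a subset \<open>B\<close>.\<close>
  also have "\<dots> = (\<Prod>k<n. ?x k + (1 - ?x k))"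
    by (rule prod_add[symmetric]) simp
  also have "\<dots> = 1" by simp
  \<comment> \<open>Substituting 0 for y and z kills every term, since each carries one of them as a
    factor.\<close>
  finally show ?thesis
    using pvars_certificate[of n \<alpha> \<beta>] linear_certificate[of n \<alpha> \<beta>]
    by (simp add: IPS_LIN_refutation_def psubst_certificate)
qed

section \<open>Branching programs as edge lists\<close>

text \<open>The components are layer, source, target, exponent and coefficient of one monomial on an
  edge.\<close>

type_synonym 'a item = "nat \<times> nat \<times> nat \<times> nat \<times> 'a"

text \<open>The output format of the machine on lists: comparing branching programs becomes
  comparing item lists.\<close>

definition items_roabp :: "(nat \<Rightarrow> nat) \<Rightarrow> 'a::comm_ring_1 item list \<Rightarrow> 'a roabp" where
  "items_roabp sz its =
     \<lparr>layer = (\<lambda>i. {..<sz i}),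
      edges = (\<lambda>i. {(u, v) | u v x c. (i, u, v, x, c) \<in> set its}),
      elabel = (\<lambda>i e. \<Sum>(l, u, v, x, c)\<leftarrow>its. if l = i \<and> (u, v) = e then monom c x else 0)\<rparr>"

text \<open>The sum over all paths from \<open>u\<close> to the end, as a recursion that replaces
  global path sums by steps between layers.\<close>

fun suffix_poly :: "'a::comm_ring_1 roabp \<Rightarrow> nat \<Rightarrow> ipsvar list \<Rightarrow> nat \<Rightarrow> 'a mpoly" where
  "suffix_poly B l [] u = 1"
| "suffix_poly B l (x # xs) u = (\<Sum>u' | u' \<in> layer B (Suc l) \<and> (u, u') \<in> edges B l.
     univariate_in x (elabel B l (u, u')) * suffix_poly B (Suc l) xs u')"

definition paths_from :: "'a::zero roabp \<Rightarrow> nat \<Rightarrow> nat \<Rightarrow> nat \<Rightarrow> nat list set" where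
  "paths_from B l k u = {p. length p = Suc k \<and> p ! 0 = u \<and> (\<forall>i\<le>k. p ! i \<in> layer B (l + i)) \<and>
     (\<forall>i<k. (p ! i, p ! Suc i) \<in> edges B (l + i))}"

lemma paths_from_Suc:
  assumes "u \<in> layer B l"
  shows "paths_from B l (Suc k) u =
    (\<Union>u'\<in>{u'. u' \<in> layer B (Suc l) \<and> (u, u') \<in> edges B l}. (#) u ` paths_from B (Suc l) k u')"
proof (intro set_eqI iffI)
  fix p assume p: "p \<in> paths_from B l (Suc k) u"
  then obtain q where q: "p = u # q" "length q = Suc k"
    by (cases p) (auto simp: paths_from_def)
  have q_layer: "q ! i \<in> layer B (Suc l + i)" if "i \<le> k" for i
    using p q that by (auto simp: paths_from_def dest!: spec[of _ "Suc i"])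
  have "(q ! i, q ! Suc i) \<in> edges B (Suc l + i)" if "i < k" for i
    using p q that by (auto simp: paths_from_def dest!: spec[of _ "Suc i"])
  moreover have "(u, q ! 0) \<in> edges B l"
    using p q by (auto simp: paths_from_def dest!: spec[of _ 0])
  ultimately have "q \<in> paths_from B (Suc l) k (q ! 0)" "q ! 0 \<in> layer B (Suc l)" "(u, q ! 0) \<in> edges B l"
    using q q_layer q_layer[of 0] by (auto simp: paths_from_def)
  then show "p \<in> (\<Union>u'\<in>{u'. u' \<in> layer B (Suc l) \<and> (u, u') \<in> edges B l}. (#) u ` paths_from B (Suc l) k u')"
    using q by blast
next
  fix p assume "p \<in> (\<Union>u'\<in>{u'. u' \<in> layer B (Suc l) \<and> (u, u') \<in> edges B l}. (#) u ` paths_from B (Suc l) k u')"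
  then show "p \<in> paths_from B l (Suc k) u"
    using assms by (auto simp: paths_from_def nth_Cons split: nat.splits)
qed

text \<open>Finiteness belongs to the induction, because splitting the sum by the second vertex
  needs finite pieces.\<close>

lemma sum_paths_from:
  assumes "\<And>i. finite (layer B i)" "u \<in> layer B l"
  shows "finite (paths_from B l (length xs) u) \<and>
    (\<Sum>p\<in>paths_from B l (length xs) u.
      \<Prod>i<length xs. univariate_in (xs ! i) (elabel B (l + i) (p ! i, p ! Suc i))) = suffix_poly B l xs u"
  using assms(2)
proof (induction xs arbitrary: l u)
  case Nil
  then have "paths_from B l 0 u = {[u]}"
    by (auto simp: paths_from_def length_Suc_conv)
  then show ?case by simp
next
  case (Cons x xs)
  let ?U = "{u'. u' \<in> layer B (Suc l) \<and> (u, u') \<in> edges B l}"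
  let ?w = "\<lambda>l xs p. \<Prod>i<length xs. univariate_in (xs ! i) (elabel B (l + i) (p ! i, p ! Suc i))"
  have U: "finite ?U" using assms(1)[of "Suc l"] by simp
  have IH: "finite (paths_from B (Suc l) (length xs) u')"
    "sum (?w (Suc l) xs) (paths_from B (Suc l) (length xs) u') = suffix_poly B (Suc l) xs u'"
    if "u' \<in> ?U" for u'
    using Cons.IH[of u' "Suc l"] that by auto
  have w: "?w l (x # xs) (u # q) = univariate_in x (elabel B l (u, u')) * ?w (Suc l) xs q"
    if "q \<in> paths_from B (Suc l) (length xs) u'" for q u'
    using that by (simp add: prod.lessThan_Suc_shift paths_from_def del: prod.lessThan_Suc)
  have "sum (?w l (x # xs)) (paths_from B l (Suc (length xs)) u)
    = (\<Sum>u'\<in>?U. sum (?w l (x # xs)) ((#) u ` paths_from B (Suc l) (length xs) u'))"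
    unfolding paths_from_Suc[OF Cons.prems]
    by (rule sum.UNION_disjoint) (use U IH in \<open>auto simp: paths_from_def\<close>)
  also have "\<dots> = (\<Sum>u'\<in>?U. \<Sum>q\<in>paths_from B (Suc l) (length xs) u'. ?w l (x # xs) (u # q))"
    by (simp add: sum.reindex o_def)
  also have "\<dots> = (\<Sum>u'\<in>?U. \<Sum>q\<in>paths_from B (Suc l) (length xs) u'.
      univariate_in x (elabel B l (u, u')) * ?w (Suc l) xs q)"
    by (intro sum.cong refl w)
  also have "\<dots> = suffix_poly B l (x # xs) u"
    unfolding suffix_poly.simps sum_distrib_left[symmetric]
    by (intro sum.cong refl arg_cong2[where f = "(*)"] IH(2))
  finally show ?case
    using U IH(1) by (auto simp: paths_from_Suc[OF Cons.prems])
qed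

lemma roabp_poly_eq_suffix_poly:
  assumes "\<And>i. finite (layer B i)" "layer B 0 = {s}"
  shows "roabp_poly vs B = suffix_poly B 0 vs s"
proof -
  have "roabp_paths (length vs) B = paths_from B 0 (length vs) s"
    using assms(2) by (auto simp: roabp_paths_def paths_from_def)
  then show ?thesis
    using sum_paths_from[OF assms(1), of s 0 vs] assms(2) by (simp add: roabp_poly_def)
qed

lemma univariate_in_0 [simp]: "univariate_in v 0 = 0"
  by (simp add: univariate_in_def)

lemma univariate_in_add: "univariate_in v (p + q) = univariate_in v p + univariate_in v q"
  by (induction p q rule: poly_induct2)
     (simp_all add: univariate_in_def poly_map_poly_PConst_pCons PConst_add algebra_simps)

lemma univariate_in_monom: "univariate_in v (monom c x) = PConst c * PVar v ^ x"
  by (simp add: univariate_in_def map_poly_monom poly_monom)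

text \<open>Labels are sums of items, so the sums over targets and over their labels merge into one
  sum over items. Targets must lie in the next layer, as \<open>suffix_poly\<close> ignores
  others.\<close>

lemma suffix_poly_items:
  fixes its :: "'a::comm_ring_1 item list"
  assumes "\<And>i u v x c. (i, u, v, x, c) \<in> set its \<Longrightarrow> i = l \<Longrightarrow> v < sz (Suc l)"
  shows "suffix_poly (items_roabp sz its) l (y # ys) u =
    (\<Sum>(i, u', v, x, c)\<leftarrow>its. if i = l \<and> u' = u
       then PConst c * PVar y ^ x * suffix_poly (items_roabp sz its) (Suc l) ys v else 0)"
proof -
  let ?B = "items_roabp sz its"
  let ?lab = "\<lambda>its e. \<Sum>(i, u, v, x, c)\<leftarrow>its. if i = l \<and> (u, v) = e then monom c x else (0 :: 'a poly)"
  have lab: "elabel ?B l = ?lab its"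
    by (simp add: items_roabp_def)
  have zero: "?lab its' (u, v) = 0"
    if "\<not> (\<exists>x c. (l, u, v, x, c) \<in> set its')" for v and its' :: "'a item list"
    using that
  proof (induction its')
    case (Cons it its')
    then show ?case by (cases it) (auto; metis)
  qed simp
  \<comment> \<open>Pairs that are not edges have label 0, so the sum may run over the entire
    layer.\<close>
  have "suffix_poly ?B l (y # ys) u =
    (\<Sum>v<sz (Suc l). univariate_in y (?lab its (u, v)) * suffix_poly ?B (Suc l) ys v)"
    unfolding suffix_poly.simps lab
  proof (rule sum.mono_neutral_left)
    show "\<forall>v\<in>{..<sz (Suc l)} - {v. v \<in> layer ?B (Suc l) \<and> (u, v) \<in> edges ?B l}.
        univariate_in y (?lab its (u, v)) * suffix_poly ?B (Suc l) ys v = 0"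
    proof
      fix v assume "v \<in> {..<sz (Suc l)} - {v. v \<in> layer ?B (Suc l) \<and> (u, v) \<in> edges ?B l}"
      then have "\<not> (\<exists>x c. (l, u, v, x, c) \<in> set its)"
        by (auto simp: items_roabp_def)
      then show "univariate_in y (?lab its (u, v)) * suffix_poly ?B (Suc l) ys v = 0"
        by (simp only: zero univariate_in_0 mult_zero_left not_False_eq_True)
    qed
  qed (auto simp: items_roabp_def)
  also have "\<dots> = (\<Sum>(i, u', v, x, c)\<leftarrow>its. if i = l \<and> u' = u
       then PConst c * PVar y ^ x * suffix_poly ?B (Suc l) ys v else 0)" (is "_ = ?rhs its")
  proof -
    have "(\<Sum>v<sz (Suc l). univariate_in y (?lab its' (u, v)) * F v) =
      (\<Sum>(i, u', v, x, c)\<leftarrow>its'. if i = l \<and> u' = u then PConst c * PVar y ^ x * F v else 0)"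
      if "set its' \<subseteq> set its" for its' and F :: "nat \<Rightarrow> 'a mpoly"
      using that
    proof (induction its')
      case (Cons it its')
      obtain i u' v x c where it: "it = (i, u', v, x, c)" by (cases it)
      have v: "v < sz (Suc l)" if "i = l" using assms Cons.prems it that by auto
      have "(\<Sum>w<sz (Suc l). univariate_in y (if i = l \<and> u' = u \<and> v = w then monom c x else 0) * F w)
        = (\<Sum>w<sz (Suc l). if v = w then (if i = l \<and> u' = u then PConst c * PVar y ^ x * F v else 0) else 0)"
        by (rule sum.cong) (auto simp: univariate_in_monom)
      also have "\<dots> = (if i = l \<and> u' = u then PConst c * PVar y ^ x * F v else 0)"
        using v by auto
      finally show ?case
        using Cons by (simp add: it univariate_in_add distrib_right sum.distrib)
    qed simp
    then show ?thesis by blast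
  qed
  finally show ?thesis .
qed

section \<open>Partial sums\<close>

definition insert_new :: "'a list \<Rightarrow> 'a \<Rightarrow> 'a list" where
  "insert_new xs x = (if x \<in> set xs then xs else xs @ [x])"

definition add_shifted :: "'a::plus \<Rightarrow> 'a list \<Rightarrow> 'a list" where
  "add_shifted a xs = fold (\<lambda>x ys. insert_new ys (x + a)) xs xs"

definition partial_sums :: "(nat \<Rightarrow> 'a::comm_ring_1) \<Rightarrow> ipsvar list \<Rightarrow> 'a list" where
  "partial_sums \<alpha> vs = fold (\<lambda>v. add_shifted (addend \<alpha> v)) vs [0]"

definition pos :: "'a list \<Rightarrow> 'a \<Rightarrow> nat" where
  "pos xs x = length (takeWhile (\<lambda>y. y \<noteq> x) xs)"

lemma pos_less: "x \<in> set xs \<Longrightarrow> pos xs x < length xs"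
  by (induction xs) (auto simp: pos_def)

lemma nth_pos: "x \<in> set xs \<Longrightarrow> xs ! pos xs x = x"
  by (induction xs) (auto simp: pos_def)

lemma nth_before_pos: "i < pos xs x \<Longrightarrow> xs ! i \<noteq> x"
  using nth_mem[of i "takeWhile (\<lambda>y. y \<noteq> x) xs"] set_takeWhileD[of "xs ! i" "\<lambda>y. y \<noteq> x" xs]
  by (simp add: pos_def takeWhile_nth)

lemma pos_append: "x \<in> set xs \<Longrightarrow> pos (xs @ ys) x = pos xs x"
  by (simp add: pos_def)

lemma fold_insert_new_prefix: "\<exists>zs. fold (\<lambda>x ys. insert_new ys (f x)) xs ys = ys @ zs"
proof (induction xs arbitrary: ys)
  case (Cons x xs)
  obtain zs where "fold (\<lambda>x ys. insert_new ys (f x)) xs (insert_new ys (f x)) = insert_new ys (f x) @ zs"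
    using Cons by blast
  then show ?case by (auto simp: insert_new_def)
qed simp

lemma add_shifted_prefix: "\<exists>zs. add_shifted a xs = xs @ zs"
  unfolding add_shifted_def by (rule fold_insert_new_prefix)

lemma set_fold_insert_new: "set (fold (\<lambda>x ys. insert_new ys (f x)) xs ys) = set ys \<union> f ` set xs"
  by (induction xs arbitrary: ys) (auto simp: insert_new_def)

lemma set_add_shifted: "set (add_shifted a xs) = set xs \<union> (\<lambda>x. x + a) ` set xs"
  unfolding add_shifted_def by (rule set_fold_insert_new)

lemma distinct_fold_insert_new: "distinct ys \<Longrightarrow> distinct (fold (\<lambda>x ys. insert_new ys (f x)) xs ys)"
  by (induction xs arbitrary: ys) (auto simp: insert_new_def)

lemma partial_sums_Nil [simp]: "partial_sums \<alpha> [] = [0]"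
  by (simp add: partial_sums_def)

lemma partial_sums_snoc: "partial_sums \<alpha> (vs @ [v]) = add_shifted (addend \<alpha> v) (partial_sums \<alpha> vs)"
  by (simp add: partial_sums_def)

lemma distinct_partial_sums: "distinct (partial_sums \<alpha> vs)"
  by (induction vs rule: rev_induct)
     (simp_all add: partial_sums_snoc add_shifted_def distinct_fold_insert_new)

lemma in_partial_sums:
  "distinct vs \<Longrightarrow> x \<in> set (partial_sums \<alpha> vs) \<Longrightarrow> \<exists>B\<subseteq>set vs. x = sum (addend \<alpha>) B"
proof (induction vs arbitrary: x rule: rev_induct)
  case (snoc v vs)
  have vs: "distinct vs" "v \<notin> set vs" using snoc.prems(1) by auto
  from snoc.prems(2) consider "x \<in> set (partial_sums \<alpha> vs)" |
    y where "y \<in> set (partial_sums \<alpha> vs)" "x = y + addend \<alpha> v"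
    unfolding partial_sums_snoc set_add_shifted by blast
  then show ?case
  proof cases
    case 1
    then obtain B where B: "B \<subseteq> set vs" "x = sum (addend \<alpha>) B" using snoc.IH[OF vs(1)] by blast
    then show ?thesis by (intro exI[of _ B]) auto
  next
    case 2
    then obtain B where B: "B \<subseteq> set vs" "y = sum (addend \<alpha>) B" using snoc.IH[OF vs(1)] by blast
    moreover have "finite B" using B(1) by (rule finite_subset) simp
    moreover have "v \<notin> B" using B(1) vs(2) by blast
    ultimately have "x = sum (addend \<alpha>) (insert v B)" using 2 by (simp add: add.commute)
    then show ?thesis using B(1) by (intro exI[of _ "insert v B"]) auto
  qed
qed simp

lemma subset_sums_eq: "subset_sums n \<alpha> = sum \<alpha> ` Pow {..<n}"
proof (intro set_eqI iffI)
  fix a assume "a \<in> subset_sums n \<alpha>"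
  then obtain x where x: "a = (\<Sum>i<n. \<alpha> i * x i)" "\<forall>i<n. x i \<in> {0, 1}"
    by (auto simp: subset_sums_def)
  have "a = (\<Sum>i<n. if i \<in> {i. i < n \<and> x i = 1} then \<alpha> i else 0)"
    unfolding x(1) by (rule sum.cong) (use x(2) in auto)
  also have "\<dots> = sum \<alpha> {i. i < n \<and> x i = 1}"
    by (subst sum.inter_restrict[symmetric]) (auto intro: sum.cong)
  finally show "a \<in> sum \<alpha> ` Pow {..<n}" by auto
qed (use sum_in_subset_sums in auto)

lemma finite_subset_sums [simp]: "finite (subset_sums n \<alpha>)"
  by (simp add: subset_sums_eq)

lemma sum_addend_in_subset_sums:
  assumes "B \<subseteq> ips_vars n"
  shows "sum (addend \<alpha>) B \<in> subset_sums n \<alpha>"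
proof -
  have fin: "finite B" using assms finite_ips_vars by (rule finite_subset)
  have "sum (addend \<alpha>) B = sum (addend \<alpha>) (X ` {i. X i \<in> B})"
  proof (rule sum.mono_neutral_right[OF fin])
    show "\<forall>v\<in>B - X ` {i. X i \<in> B}. addend \<alpha> v = 0"
    proof
      fix v assume "v \<in> B - X ` {i. X i \<in> B}"
      then show "addend \<alpha> v = 0" by (cases v) auto
    qed
  qed auto
  also have "\<dots> = sum \<alpha> {i. X i \<in> B}"
    by (subst sum.reindex) (auto simp: inj_on_def)
  finally show ?thesis
    using assms by (auto simp: subset_sums_eq ips_vars_def)
qed

lemma set_partial_sums:
  assumes "distinct vs" "set vs \<subseteq> ips_vars n"
  shows "set (partial_sums \<alpha> vs) \<subseteq> subset_sums n \<alpha>"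
proof
  fix x assume "x \<in> set (partial_sums \<alpha> vs)"
  then obtain B where "B \<subseteq> set vs" "x = sum (addend \<alpha>) B"
    using in_partial_sums[OF assms(1)] by blast
  then show "x \<in> subset_sums n \<alpha>"
    using sum_addend_in_subset_sums[of B n \<alpha>] assms(2) by auto
qed

lemma length_partial_sums:
  assumes "distinct vs" "set vs \<subseteq> ips_vars n"
  shows "length (partial_sums \<alpha> vs) \<le> card (subset_sums n \<alpha>)"
  using card_mono[OF finite_subset_sums set_partial_sums[OF assms], of \<alpha>]
  by (simp add: distinct_card distinct_partial_sums)

section \<open>A branching program for the refutation\<close>

fun branch_poly :: "(nat \<Rightarrow> 'a::field) \<Rightarrow> 'a \<Rightarrow> nat \<Rightarrow> ipsvar list \<Rightarrow> 'a \<Rightarrow> 'a mpoly" where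
  "branch_poly \<alpha> \<beta> j [] a = PConst (1 / (a - \<beta>))"
| "branch_poly \<alpha> \<beta> j (v # vs) a =
     univariate_in v (stay \<alpha> j v) * branch_poly \<alpha> \<beta> j vs a +
     univariate_in v (move \<alpha> j v) * branch_poly \<alpha> \<beta> j vs (a + addend \<alpha> v)"

lemma branch_poly_eq:
  assumes "distinct vs"
  shows "branch_poly \<alpha> \<beta> j vs a = (\<Sum>B\<in>Pow (set vs). PConst (1 / (a + sum (addend \<alpha>) B - \<beta>)) *
     ((\<Prod>v\<in>B. univariate_in v (move \<alpha> j v)) * (\<Prod>v\<in>set vs - B. univariate_in v (stay \<alpha> j v))))"
  using assms
proof (induction vs arbitrary: a)
  case (Cons v vs)
  let ?m = "\<lambda>v. univariate_in v (move \<alpha> j v)" and ?s = "\<lambda>v. univariate_in v (stay \<alpha> j v)"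
  let ?f = "\<lambda>a W B. PConst (1 / (a + sum (addend \<alpha>) B - \<beta>)) * (prod ?m B * prod ?s (W - B))"
  have v: "v \<notin> set vs" and d: "distinct vs" using Cons.prems by auto
  have "sum (?f a (set (v # vs))) (Pow (set (v # vs))) =
    sum (?f a (insert v (set vs))) (Pow (set vs)) + sum (?f a (insert v (set vs))) (insert v ` Pow (set vs))"
    unfolding list.set Pow_insert by (rule sum.union_disjoint) (use v in auto)
  also have "sum (?f a (insert v (set vs))) (Pow (set vs)) = ?s v * sum (?f a (set vs)) (Pow (set vs))"
    unfolding sum_distrib_left
  proof (rule sum.cong[OF refl])
    fix B assume "B \<in> Pow (set vs)"
    then have "insert v (set vs) - B = insert v (set vs - B)" "v \<notin> set vs - B" using v by auto
    then show "?f a (insert v (set vs)) B = ?s v * ?f a (set vs) B"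
      by (simp add: mult_ac)
  qed
  also have "sum (?f a (insert v (set vs))) (insert v ` Pow (set vs)) =
      (\<Sum>B\<in>Pow (set vs). ?f a (insert v (set vs)) (insert v B))"
    by (subst sum.reindex) (use v in \<open>auto simp: inj_on_def\<close>)
  also have "\<dots> = ?m v * sum (?f (a + addend \<alpha> v) (set vs)) (Pow (set vs))"
    unfolding sum_distrib_left
  proof (rule sum.cong[OF refl])
    fix B assume B: "B \<in> Pow (set vs)"
    then have "insert v (set vs) - insert v B = set vs - B" "v \<notin> B" "finite B"
      using v finite_subset by auto
    then show "?f a (insert v (set vs)) (insert v B) = ?m v * ?f (a + addend \<alpha> v) (set vs) B"
      by (simp add: mult_ac add_ac)
  qed
  finally show ?case
    using Cons.IH[OF d] by simp
qed simp

lemma certificate_eq_branches: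
  assumes "variable_order n vs"
  shows "certificate n \<alpha> \<beta> = (\<Sum>j\<le>n. branch_poly \<alpha> \<beta> j vs 0)"
  using assms by (simp add: variable_order_def branch_poly_eq certificate_def)

text \<open>The vertex for branch \<open>j\<close> and the partial sum with index \<open>p\<close>; the first and the last layer
  are singletons.\<close>

definition vertex :: "nat \<Rightarrow> nat \<Rightarrow> nat \<Rightarrow> nat \<Rightarrow> nat \<Rightarrow> nat" where
  "vertex n N l p j = (if l = 0 \<or> l = N then 0 else p * Suc n + j)"

definition layer_size :: "nat \<Rightarrow> (nat \<Rightarrow> 'a::field) \<Rightarrow> ipsvar list \<Rightarrow> nat \<Rightarrow> nat" where
  "layer_size n \<alpha> vs l = (if l = 0 \<or> l = length vs then 1
     else if l < length vs then length (partial_sums \<alpha> (take l vs)) * Suc n else 0)"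

definition final_weight :: "'a::field \<Rightarrow> nat \<Rightarrow> nat \<Rightarrow> 'a \<Rightarrow> 'a" where
  "final_weight \<beta> N l a = (if l = N then 1 / (a - \<beta>) else 1)"

definition edge_items :: "nat \<Rightarrow> (nat \<Rightarrow> 'a::field) \<Rightarrow> 'a \<Rightarrow> ipsvar list \<Rightarrow> nat \<Rightarrow> nat \<Rightarrow> nat \<Rightarrow> 'a item list" where
  "edge_items n \<alpha> \<beta> vs l p j = (let N = length vs; v = vs ! l;
     ys = partial_sums \<alpha> (take (Suc l) vs);
     a = ys ! p; b = a + addend \<alpha> v; u = vertex n N l p j;
     t = vertex n N (Suc l) p j; t' = vertex n N (Suc l) (pos ys b) j;
     w = final_weight \<beta> N (Suc l) a; w' = final_weight \<beta> N (Suc l) b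
   in [(l, u, t, 0, coeff (stay \<alpha> j v) 0 * w), (l, u, t, 1, coeff (stay \<alpha> j v) 1 * w),
       (l, u, t', 0, coeff (move \<alpha> j v) 0 * w'), (l, u, t', 1, coeff (move \<alpha> j v) 1 * w')])"

definition sum_items :: "nat \<Rightarrow> (nat \<Rightarrow> 'a::field) \<Rightarrow> 'a \<Rightarrow> ipsvar list \<Rightarrow> nat \<Rightarrow> nat \<Rightarrow> 'a item list" where
  "sum_items n \<alpha> \<beta> vs l p = concat (map (edge_items n \<alpha> \<beta> vs l p) [0..<Suc n])"

definition layer_items :: "nat \<Rightarrow> (nat \<Rightarrow> 'a::field) \<Rightarrow> 'a \<Rightarrow> ipsvar list \<Rightarrow> nat \<Rightarrow> 'a item list" where
  "layer_items n \<alpha> \<beta> vs l = concat (map (sum_items n \<alpha> \<beta> vs l) [0..<length (partial_sums \<alpha> (take l vs))])"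

definition refutation_items :: "nat \<Rightarrow> (nat \<Rightarrow> 'a::field) \<Rightarrow> 'a \<Rightarrow> ipsvar list \<Rightarrow> 'a item list" where
  "refutation_items n \<alpha> \<beta> vs = concat (map (layer_items n \<alpha> \<beta> vs) [0..<length vs])"

definition refutation_roabp :: "nat \<Rightarrow> (nat \<Rightarrow> 'a::field) \<Rightarrow> 'a \<Rightarrow> ipsvar list \<Rightarrow> 'a roabp" where
  "refutation_roabp n \<alpha> \<beta> vs = items_roabp (layer_size n \<alpha> vs) (refutation_items n \<alpha> \<beta> vs)"

lemma partial_sums_take_Suc:
  "l < length vs \<Longrightarrow> partial_sums \<alpha> (take (Suc l) vs) = add_shifted (addend \<alpha> (vs ! l)) (partial_sums \<alpha> (take l vs))"
  by (simp add: take_Suc_conv_app_nth partial_sums_snoc)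

lemma partial_sums_take_prefix:
  assumes "l < length vs"
  shows "\<exists>zs. partial_sums \<alpha> (take (Suc l) vs) = partial_sums \<alpha> (take l vs) @ zs"
  unfolding partial_sums_take_Suc[OF assms] by (rule add_shifted_prefix)

lemma mem_refutation_items:
  "it \<in> set (refutation_items n \<alpha> \<beta> vs) \<longleftrightarrow> (\<exists>l<length vs. \<exists>p<length (partial_sums \<alpha> (take l vs)). \<exists>j\<le>n.
     it \<in> set (edge_items n \<alpha> \<beta> vs l p j))"
  unfolding refutation_items_def layer_items_def sum_items_def
  by (simp add: Bex_def less_Suc_eq_le del: upt_Suc)

lemma vertex_less:
  assumes "p < length (partial_sums \<alpha> (take l vs))" "j \<le> n" "l \<le> length vs"
  shows "vertex n (length vs) l p j < layer_size n \<alpha> vs l"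
proof -
  have "p * Suc n + j < Suc p * Suc n" using assms(2) by simp
  also have "\<dots> \<le> length (partial_sums \<alpha> (take l vs)) * Suc n"
    using assms(1) by (intro mult_right_mono) auto
  finally show ?thesis using assms(3) by (simp add: vertex_def layer_size_def del: mult_Suc_right)
qed

lemma refutation_item_bounds:
  assumes "(i, u, v, x, c) \<in> set (refutation_items n \<alpha> \<beta> vs)"
  shows "i < length vs" "u < layer_size n \<alpha> vs i" "v < layer_size n \<alpha> vs (Suc i)"
proof -
  obtain l p j where l: "l < length vs" and p: "p < length (partial_sums \<alpha> (take l vs))" and j: "j \<le> n"
    and it: "(i, u, v, x, c) \<in> set (edge_items n \<alpha> \<beta> vs l p j)"
    using assms unfolding mem_refutation_items by blast
  let ?xs = "partial_sums \<alpha> (take l vs)" and ?ys = "partial_sums \<alpha> (take (Suc l) vs)"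
  obtain zs where zs: "?ys = ?xs @ zs" using partial_sums_take_prefix[OF l] by blast
  have "?ys ! p + addend \<alpha> (vs ! l) \<in> set ?ys"
    unfolding partial_sums_take_Suc[OF l] set_add_shifted
    using p zs by (simp add: partial_sums_take_Suc[OF l] nth_append)
  then have "pos ?ys (?ys ! p + addend \<alpha> (vs ! l)) < length ?ys" by (rule pos_less)
  moreover have "p < length ?ys" using p zs by simp
  ultimately show "i < length vs" "u < layer_size n \<alpha> vs i" "v < layer_size n \<alpha> vs (Suc i)"
    using it l vertex_less[OF p j] vertex_less[OF _ j, of _ \<alpha> "Suc l" vs]
    by (auto simp: edge_items_def Let_def)
qed

lemma sum_list_concat_map: "sum_list (map f (concat xss)) = (\<Sum>xs\<leftarrow>xss. sum_list (map f xs))"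
  by (induction xss) simp_all

lemma vertex_inject:
  assumes "j \<le> n" "j' \<le> n"
  shows "p * Suc n + j = p' * Suc n + j' \<longleftrightarrow> p = p' \<and> j = j'"
proof
  assume eq: "p * Suc n + j = p' * Suc n + j'"
  have "(p * Suc n + j) div Suc n = p" "(p' * Suc n + j') div Suc n = p'" "(p * Suc n + j) mod Suc n = j" "(p' * Suc n + j') mod Suc n = j'"
    using assms by (simp_all del: mult_Suc_right)
  then show "p = p' \<and> j = j'" unfolding eq by simp
qed simp

lemma degree_stay: "degree (stay \<alpha> j v) \<le> 1"
  by (cases v) auto

lemma degree_move: "degree (move \<alpha> j v) \<le> 1"
  by (cases v) auto

lemma univariate_in_linear:
  assumes "degree q \<le> 1"
  shows "univariate_in v q = PConst (coeff q 0) + PConst (coeff q 1) * PVar v"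
proof -
  have "q = monom (coeff q 0) 0 + monom (coeff q 1) 1"
    using poly_as_sum_of_monoms'[OF assms] by (simp add: add.commute)
  then have "univariate_in v q = univariate_in v (monom (coeff q 0) 0 + monom (coeff q 1) 1)"
    by simp
  then show ?thesis by (simp add: univariate_in_add univariate_in_monom)
qed

lemma suffix_poly_refutation:
  fixes \<alpha> :: "nat \<Rightarrow> 'a::field"
  defines "S \<equiv> \<lambda>vs l. partial_sums \<alpha> (take l vs)"
  assumes l: "l < length vs"
    and next_layer: "\<And>p j. p < length (S vs (Suc l)) \<Longrightarrow> j \<le> n \<Longrightarrow>
      PConst (final_weight \<beta> (length vs) (Suc l) (S vs (Suc l) ! p)) *
      suffix_poly (refutation_roabp n \<alpha> \<beta> vs) (Suc l) (drop (Suc l) vs) (vertex n (length vs) (Suc l) p j) =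
      branch_poly \<alpha> \<beta> j (drop (Suc l) vs) (S vs (Suc l) ! p)"
  shows "suffix_poly (refutation_roabp n \<alpha> \<beta> vs) l (drop l vs) u =
    (\<Sum>p<length (S vs l). \<Sum>j\<le>n. if vertex n (length vs) l p j = u
       then branch_poly \<alpha> \<beta> j (drop l vs) (S vs l ! p) else 0)"
proof -
  let ?B = "refutation_roabp n \<alpha> \<beta> vs" and ?v = "vs ! l" and ?N = "length vs"
  let ?F = "suffix_poly ?B (Suc l) (drop (Suc l) vs)"
  let ?g = "\<lambda>(i, u', v, x, c). if i = l \<and> u' = u then PConst c * PVar ?v ^ x * ?F v else 0"
  have d: "drop l vs = ?v # drop (Suc l) vs" using l by (simp add: Cons_nth_drop_Suc)
  obtain zs where zs: "S vs (Suc l) = S vs l @ zs" using partial_sums_take_prefix[OF l] S_def by metis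
  have edge: "(\<Sum>it\<leftarrow>edge_items n \<alpha> \<beta> vs i p j. ?g it) =
      (if i = l then if vertex n ?N l p j = u then branch_poly \<alpha> \<beta> j (drop l vs) (S vs l ! p) else 0 else 0)"
    if p: "p < length (S vs i)" and j: "j \<le> n" for i p j
  proof (cases "i = l \<and> vertex n ?N l p j = u")
    case True
    then have [simp]: "i = l" and u: "u = vertex n ?N l p j" by auto
    let ?ys = "S vs (Suc l)"
    let ?a = "?ys ! p" and ?b = "?ys ! p + addend \<alpha> ?v"
    let ?w = "final_weight \<beta> ?N (Suc l)"
    have a: "?a = S vs l ! p" and p': "p < length ?ys" using p zs by (auto simp: nth_append)
    have b: "?b \<in> set ?ys"
      using p a by (simp add: S_def partial_sums_take_Suc[OF l] set_add_shifted)
    have "(\<Sum>it\<leftarrow>edge_items n \<alpha> \<beta> vs i p j. ?g it) =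
        univariate_in ?v (stay \<alpha> j ?v) * (PConst (?w ?a) * ?F (vertex n ?N (Suc l) p j)) +
        univariate_in ?v (move \<alpha> j ?v) * (PConst (?w ?b) * ?F (vertex n ?N (Suc l) (pos ?ys ?b) j))"
      by (simp add: edge_items_def Let_def S_def u univariate_in_linear[OF degree_stay]
          univariate_in_linear[OF degree_move] PConst_mult algebra_simps)
    also have "PConst (?w ?a) * ?F (vertex n ?N (Suc l) p j) = branch_poly \<alpha> \<beta> j (drop (Suc l) vs) ?a"
      by (rule next_layer[OF p' j])
    also have "PConst (?w ?b) * ?F (vertex n ?N (Suc l) (pos ?ys ?b) j) = branch_poly \<alpha> \<beta> j (drop (Suc l) vs) ?b"
      using next_layer[OF pos_less[OF b] j] by (simp add: nth_pos[OF b])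
    finally show ?thesis using u a by (simp add: d)
  qed (auto simp: edge_items_def Let_def)
  have sums: "(\<Sum>it\<leftarrow>layer_items n \<alpha> \<beta> vs i. ?g it) =
      (\<Sum>p<length (S vs i). \<Sum>j\<le>n. if i = l then if vertex n ?N l p j = u
          then branch_poly \<alpha> \<beta> j (drop l vs) (S vs l ! p) else 0 else 0)" for i
    unfolding layer_items_def sum_items_def sum_list_concat_map map_map o_def interv_sum_list_conv_sum_set_nat
      S_def[symmetric] atLeast0LessThan lessThan_Suc_atMost
    by (intro sum.cong refl edge) (auto simp: S_def)
  have "suffix_poly ?B l (drop l vs) u = (\<Sum>it\<leftarrow>refutation_items n \<alpha> \<beta> vs. ?g it)"
    unfolding d refutation_roabp_def
    by (rule suffix_poly_items) (use refutation_item_bounds(3) in auto)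
  also have "\<dots> = (\<Sum>i<?N. \<Sum>it\<leftarrow>layer_items n \<alpha> \<beta> vs i. ?g it)"
    unfolding refutation_items_def sum_list_concat_map map_map o_def interv_sum_list_conv_sum_set_nat
    by (simp add: atLeast0LessThan)
  also have "\<dots> = (\<Sum>i\<in>{l}. \<Sum>it\<leftarrow>layer_items n \<alpha> \<beta> vs i. ?g it)"
    by (rule sum.mono_neutral_right) (use l in \<open>auto simp: sums\<close>)
  finally show ?thesis by (simp add: sums)
qed

lemma suffix_poly_eq_branch_poly:
  assumes "0 < l" "l \<le> length vs" "p < length (partial_sums \<alpha> (take l vs))" "j \<le> n"
  shows "PConst (final_weight \<beta> (length vs) l (partial_sums \<alpha> (take l vs) ! p)) *
      suffix_poly (refutation_roabp n \<alpha> \<beta> vs) l (drop l vs) (vertex n (length vs) l p j) =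
      branch_poly \<alpha> \<beta> j (drop l vs) (partial_sums \<alpha> (take l vs) ! p)"
  using assms(2,1,3,4)
proof (induction l arbitrary: p j rule: inc_induct)
  case base
  then show ?case by (simp add: final_weight_def)
next
  case (step l)
  let ?xs = "partial_sums \<alpha> (take l vs)"
  have "suffix_poly (refutation_roabp n \<alpha> \<beta> vs) l (drop l vs) (vertex n (length vs) l p j) =
    (\<Sum>p'<length ?xs. \<Sum>j'\<le>n. if vertex n (length vs) l p' j' = vertex n (length vs) l p j
       then branch_poly \<alpha> \<beta> j' (drop l vs) (?xs ! p') else 0)"
    by (rule suffix_poly_refutation) (use step in auto)
  also have "\<dots> = (\<Sum>p'<length ?xs. \<Sum>j'\<le>n. if p' = p then if j' = j
       then branch_poly \<alpha> \<beta> j (drop l vs) (?xs ! p) else 0 else 0)"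
    using step by (intro sum.cong refl) (auto simp: vertex_def vertex_inject simp del: mult_Suc_right)
  also have "\<dots> = (\<Sum>p'<length ?xs. if p' = p then
       branch_poly \<alpha> \<beta> j (drop l vs) (?xs ! p) else 0)"
    using step.prems by (intro sum.cong refl) auto
  also have "\<dots> = branch_poly \<alpha> \<beta> j (drop l vs) (?xs ! p)"
    using step.prems by simp
  finally show ?case using step by (simp add: final_weight_def)
qed

lemma length_variable_order:
  assumes "variable_order n vs"
  shows "length vs = 2 * n + 1"
proof -
  have "card (X ` {..<n} \<union> ({Y} \<union> Z ` {..<n})) = n + (1 + n)"
    by (subst card_Un_disjoint; (subst card_Un_disjoint)?) (auto simp: card_image inj_on_def)
  then show ?thesis
    using assms distinct_card[of vs] by (simp add: variable_order_def ips_vars_def Un_assoc)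
qed

lemma roabp_poly_refutation:
  assumes "variable_order n vs"
  shows "roabp_poly vs (refutation_roabp n \<alpha> \<beta> vs) = certificate n \<alpha> \<beta>"
proof -
  let ?B = "refutation_roabp n \<alpha> \<beta> vs"
  have N: "0 < length vs" using length_variable_order[OF assms] by simp
  have "roabp_poly vs ?B = suffix_poly ?B 0 (drop 0 vs) 0"
    using roabp_poly_eq_suffix_poly[of ?B 0]
    by (simp add: refutation_roabp_def items_roabp_def layer_size_def lessThan_Suc)
  also have "\<dots> = (\<Sum>p<length (partial_sums \<alpha> (take 0 vs)). \<Sum>j\<le>n. if vertex n (length vs) 0 p j = 0
       then branch_poly \<alpha> \<beta> j (drop 0 vs) (partial_sums \<alpha> (take 0 vs) ! p) else 0)"
    by (rule suffix_poly_refutation) (use N in \<open>auto simp: Suc_le_eq intro!: suffix_poly_eq_branch_poly\<close>)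
  also have "\<dots> = certificate n \<alpha> \<beta>"
    by (simp add: vertex_def certificate_eq_branches[OF assms])
  finally show ?thesis .
qed

lemma refutation_roabp_computes:
  fixes \<alpha> :: "nat \<Rightarrow> 'a::field"
  assumes "variable_order n vs"
  shows "roabp_computes (card (subset_sums n \<alpha>) * Suc n) vs (refutation_roabp n \<alpha> \<beta> vs) (certificate n \<alpha> \<beta>)"
proof -
  have vs: "distinct vs" "set vs = ips_vars n" using assms by (auto simp: variable_order_def)
  have "length (partial_sums \<alpha> (take l vs)) \<le> card (subset_sums n \<alpha>)" for l
    by (rule length_partial_sums) (use vs set_take_subset[of l vs] in auto)
  then have "length (partial_sums \<alpha> (take l vs)) * Suc n \<le> card (subset_sums n \<alpha>) * Suc n" for l
    by (intro mult_right_mono) auto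
  moreover have "0 < card (subset_sums n \<alpha>)"
    by (auto simp: card_gt_0_iff subset_sums_eq)
  ultimately have "layer_size n \<alpha> vs l \<le> card (subset_sums n \<alpha>) * Suc n" for l
    by (simp add: layer_size_def del: mult_Suc_right)
  then have "is_roabp (card (subset_sums n \<alpha>) * Suc n) (length vs) (refutation_roabp n \<alpha> \<beta> vs)"
    using refutation_item_bounds[of _ _ _ _ _ n \<alpha> \<beta> vs]
    by (auto simp: is_roabp_def refutation_roabp_def items_roabp_def lessThan_Suc layer_size_def[of _ _ _ 0]
        layer_size_def[of _ _ _ "length vs"])
  then show ?thesis
    by (simp add: roabp_computes_def roabp_poly_refutation[OF assms])
qed

section \<open>Running time of programs\<close>

definition runs :: "com \<Rightarrow> 'a::field state \<Rightarrow> nat \<Rightarrow> ('a state \<Rightarrow> bool) \<Rightarrow> bool" where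
  "runs c s t Q \<longleftrightarrow> (\<exists>k s'. exec c s k s' \<and> k \<le> t \<and> Q s')"

lemma runs_mono: "runs c s t Q \<Longrightarrow> t \<le> t' \<Longrightarrow> (\<And>s'. Q s' \<Longrightarrow> Q' s') \<Longrightarrow> runs c s t' Q'"
  unfolding runs_def by (meson le_trans)

lemma runs_Seq:
  assumes "runs c1 s t1 Q1" "\<And>s'. Q1 s' \<Longrightarrow> runs c2 s' t2 Q"
  shows "runs (Seq c1 c2) s (t1 + t2) Q"
  using assms unfolding runs_def by (meson Seq add_mono)

lemma runs_While:
  assumes "I 0 s"
    and step: "\<And>i s'. i < M \<Longrightarrow> I i s' \<Longrightarrow> bval b s' \<and> runs c s' t (I (Suc i))"
    and exit: "\<And>s'. I M s' \<Longrightarrow> \<not> bval b s'"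
  shows "runs (While b c) s (M * (1 + bcost b + t) + (1 + bcost b)) (I M)"
proof -
  have "runs (While b c) s' ((M - i) * (1 + bcost b + t) + (1 + bcost b)) (I M)"
    if "i \<le> M" "I i s'" for i s'
    using that
  proof (induction i arbitrary: s' rule: inc_induct)
    case base
    then show ?case using WhileFalse exit by (fastforce simp: runs_def)
  next
    case (step i)
    then obtain k s1 where k: "bval b s'" "exec c s' k s1" "k \<le> t" "I (Suc i) s1"
      using assms(2)[of i s'] by (auto simp: runs_def)
    then obtain k' s2 where k': "exec (While b c) s1 k' s2" "I M s2"
      "k' \<le> (M - Suc i) * (1 + bcost b + t) + (1 + bcost b)"
      using step.IH[OF k(4)] unfolding runs_def by blast
    have "exec (While b c) s' (1 + bcost b + k + k') s2"
      using k k' by (intro WhileTrue) auto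
    moreover have "M - i = Suc (M - Suc i)" using step.hyps by simp
    then have "1 + bcost b + k + k' \<le> (M - i) * (1 + bcost b + t) + (1 + bcost b)"
      using k(3) k'(3) by simp
    ultimately show ?case using k' unfolding runs_def by blast
  qed
  from this[of 0 s] assms(1) show ?thesis by simp
qed

fun loop_free :: "com \<Rightarrow> bool" where
  "loop_free (Seq c1 c2) = (loop_free c1 \<and> loop_free c2)"
| "loop_free (Cond b c1 c2) = (loop_free c1 \<and> loop_free c2)"
| "loop_free (While b c) = False"
| "loop_free c = True"

fun effect :: "com \<Rightarrow> 'a::field state \<Rightarrow> 'a state" where
  "effect Skip s = s"
| "effect (SetReg x e) s = s\<lparr>reg := (reg s)(x := nval e s)\<rparr>"
| "effect (NPut a i e) s = s\<lparr>narr := (narr s)(a := (narr s a)(nval i s := nval e s))\<rparr>"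
| "effect (FPut a i e) s = s\<lparr>farr := (farr s)(a := (farr s a)(nval i s := fval e s))\<rparr>"
| "effect (Seq c1 c2) s = effect c2 (effect c1 s)"
| "effect (Cond b c1 c2) s = (if bval b s then effect c1 s else effect c2 s)"
| "effect (While b c) s = s"

fun max_cost :: "com \<Rightarrow> nat" where
  "max_cost Skip = 1"
| "max_cost (SetReg x e) = 1 + ncost e"
| "max_cost (NPut a i e) = 1 + ncost i + ncost e"
| "max_cost (FPut a i e) = 1 + ncost i + fcost e"
| "max_cost (Seq c1 c2) = max_cost c1 + max_cost c2"
| "max_cost (Cond b c1 c2) = 1 + bcost b + max (max_cost c1) (max_cost c2)"
| "max_cost (While b c) = 0"

lemma exec_effect: "loop_free c \<Longrightarrow> \<exists>k\<le>max_cost c. exec c s k (effect c s)"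
proof (induction c arbitrary: s)
  case (Seq c1 c2)
  then obtain k1 k2 where "k1 \<le> max_cost c1" "exec c1 s k1 (effect c1 s)"
    "k2 \<le> max_cost c2" "exec c2 (effect c1 s) k2 (effect c2 (effect c1 s))"
    by (metis loop_free.simps(1))
  then show ?case by (intro exI[of _ "k1 + k2"]) (auto intro: exec.Seq)
next
  case (Cond b c1 c2)
  then obtain k1 k2 where "k1 \<le> max_cost c1" "exec c1 s k1 (effect c1 s)"
    "k2 \<le> max_cost c2" "exec c2 s k2 (effect c2 s)"
    by (metis loop_free.simps(2))
  then show ?case
    by (intro exI[of _ "1 + bcost b + (if bval b s then k1 else k2)"])
       (auto simp del: add_Suc intro: CondTrue[simplified] CondFalse[simplified])
qed (auto intro: exec.intros[simplified])

lemma runs_effect: "loop_free c \<Longrightarrow> Q (effect c s) \<Longrightarrow> runs c s (max_cost c) Q"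
  using exec_effect unfolding runs_def by blast

lemma runs_code:
  assumes "loop_free c" "max_cost c \<le> 300" "Q (effect c s)"
  shows "runs c s 300 Q"
  using runs_mono[OF runs_effect[of c Q s]] assms by blast

lemma runs_between:
  assumes "loop_free c1" "max_cost c1 \<le> 300" "loop_free c3" "max_cost c3 \<le> 300"
    and "runs c2 (effect c1 s) t I" "\<And>s'. I s' \<Longrightarrow> Q (effect c3 s')"
  shows "runs (Seq c1 (Seq c2 c3)) s (300 + (t + 300)) Q"
proof (rule runs_Seq)
  show "runs c1 s 300 (\<lambda>s'. s' = effect c1 s)"
    by (rule runs_code) (use assms in auto)
  show "runs (Seq c2 c3) s' (t + 300) Q" if "s' = effect c1 s" for s'
    using that assms by (auto intro: runs_Seq runs_code)
qed

section \<open>A program that constructs the branching program\<close>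

definition output_items :: "'a state \<Rightarrow> 'a item list" where
  "output_items s = map (\<lambda>k. (narr s 2 k, narr s 3 k, narr s 4 k, narr s 5 k, farr s 2 k)) [0..<reg s 1]"

lemma mem_output_items:
  "(i, u, v, x, c) \<in> set (output_items s) \<longleftrightarrow> (\<exists>k<reg s 1. i = narr s 2 k \<and> u = narr s 3 k \<and> v = narr s 4 k \<and>
     x = narr s 5 k \<and> c = farr s 2 k)"
  by (auto simp: output_items_def image_iff)

lemma output_roabp_eq: "output_roabp s = items_roabp (narr s 1) (output_items s)"
proof -
  have "(\<Sum>k | k < reg s 1 \<and> narr s 2 k = i \<and> (narr s 3 k, narr s 4 k) = e. monom (farr s 2 k) (narr s 5 k))
    = (\<Sum>k<reg s 1. if narr s 2 k = i \<and> (narr s 3 k, narr s 4 k) = e then monom (farr s 2 k) (narr s 5 k) else 0)"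
    for i e
    by (subst sum.inter_filter[symmetric]) (auto intro: sum.cong)
  then have "elabel (output_roabp s) = elabel (items_roabp (narr s 1) (output_items s))"
    by (simp add: fun_eq_iff output_roabp_def items_roabp_def output_items_def o_def
        interv_sum_list_conv_sum_set_nat atLeast0LessThan)
  moreover have "edges (output_roabp s) = edges (items_roabp (narr s 1) (output_items s))"
    by (fastforce simp: fun_eq_iff output_roabp_def items_roabp_def mem_output_items)
  ultimately show ?thesis
    by (simp add: output_roabp_def items_roabp_def)
qed

lemma output_items_update [simp]:
  "r (Suc 0) = reg s (Suc 0) \<Longrightarrow> output_items (s\<lparr>reg := r\<rparr>) = output_items s"
  "f 2 = farr s 2 \<Longrightarrow> output_items (s\<lparr>farr := f\<rparr>) = output_items s"
  "g 2 = narr s 2 \<Longrightarrow> g 3 = narr s 3 \<Longrightarrow> g 4 = narr s 4 \<Longrightarrow> g 5 = narr s 5 \<Longrightarrow>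
     output_items (s\<lparr>narr := g\<rparr>) = output_items s"
  by (simp_all add: output_items_def)

definition stored_sums :: "'a state \<Rightarrow> 'a list" where
  "stored_sums s = map (farr s 3) [0..<reg s 3]"

definition frame :: "nat set \<Rightarrow> nat set \<Rightarrow> 'a state \<Rightarrow> 'a state \<Rightarrow> bool" where
  "frame R F s s' \<longleftrightarrow> (\<forall>x. x \<notin> R \<longrightarrow> reg s' x = reg s x) \<and> narr s' 0 = narr s 0 \<and> narr s' 1 = narr s 1 \<and>
     (\<forall>a. a \<notin> F \<longrightarrow> farr s' a = farr s a)"

lemma frame_trans: "frame R F s s' \<Longrightarrow> frame R' F' s' s'' \<Longrightarrow> R \<subseteq> R'' \<Longrightarrow> R' \<subseteq> R'' \<Longrightarrow> F \<subseteq> F'' \<Longrightarrow> F' \<subseteq> F'' \<Longrightarrow> frame R'' F'' s s''"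
  unfolding frame_def by (metis subsetD)

text \<open>Registers: 0 \<open>n\<close>, 1 number of output items, 2 current layer \<open>l\<close>, 3 number of known partial sums,
  4 that number times \<open>n + 1\<close>, 5 index \<open>p\<close> of the current partial sum, 6 number of partial sums in
  layer \<open>l\<close>, 7 index \<open>q\<close> of the shifted partial sum, 8 \<open>q * (n + 1)\<close>, 9 branch \<open>j\<close>, 10 source,
  11 \<open>p * (n + 1)\<close>, 12 number of variables, 13 code of the current variable, 14 and 15 targets.
  Field arrays: 3 partial sums; 4 addend of the current variable and the two final weights;
  5 coefficients of the current labels.\<close>

abbreviation seqs :: "com list \<Rightarrow> com" where
  "seqs cs \<equiv> foldr Seq cs Skip"

definition emit :: "nat \<Rightarrow> nat \<Rightarrow> nat \<Rightarrow> nat \<Rightarrow> com" where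
  "emit r x k w = seqs
     [NPut 2 (Reg 1) (Reg 2), NPut 3 (Reg 1) (Reg 10), NPut 4 (Reg 1) (Reg r), NPut 5 (Reg 1) (NConst x),
      FPut 2 (Reg 1) (FMul (FGet 5 (NConst k)) (FGet 4 (NConst w))), SetReg 1 (NAdd (Reg 1) (NConst 1))]"

definition put_coeffs :: "fexp \<Rightarrow> fexp \<Rightarrow> fexp \<Rightarrow> fexp \<Rightarrow> com" where
  "put_coeffs a b c d = seqs
     [FPut 5 (NConst 0) a, FPut 5 (NConst 1) b, FPut 5 (NConst 2) c, FPut 5 (NConst 3) d]"

definition NEqual :: "nexp \<Rightarrow> nexp \<Rightarrow> bexp" where
  "NEqual a b = BAnd (BNot (NLess a b)) (BNot (NLess b a))"

definition label_code :: com where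
  "label_code = Cond (NLess (Reg 13) (Reg 0))
     (Cond (NEqual (Reg 9) (NAdd (Reg 13) (NConst 1)))
       (put_coeffs (FGet 4 (NConst 0)) FZero (FSub FZero (FGet 4 (NConst 0))) FZero)
       (put_coeffs FOne (FSub FZero FOne) FZero FOne))
     (Cond (NEqual (Reg 13) (NAdd (Reg 0) (Reg 9)))
       (put_coeffs FZero FOne FZero FZero)
       (put_coeffs FOne FZero FZero FZero))"

definition vertex_code :: com where
  "vertex_code = seqs
     [Cond (NLess (NConst 0) (Reg 2)) (SetReg 10 (NAdd (Reg 11) (Reg 9))) (SetReg 10 (NConst 0)),
      Cond (NLess (NAdd (Reg 2) (NConst 1)) (Reg 12))
        (Seq (SetReg 14 (NAdd (Reg 11) (Reg 9))) (SetReg 15 (NAdd (Reg 8) (Reg 9))))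
        (Seq (SetReg 14 (NConst 0)) (SetReg 15 (NConst 0)))]"

definition branch_code :: com where
  "branch_code = seqs [label_code, vertex_code, emit 14 0 0 1, emit 14 1 1 1, emit 15 0 2 2, emit 15 1 3 2,
     SetReg 9 (NAdd (Reg 9) (NConst 1))]"

definition branches_code :: com where
  "branches_code = Seq (SetReg 9 (NConst 0)) (While (NLess (Reg 9) (NAdd (Reg 0) (NConst 1))) branch_code)"

definition search_step :: com where
  "search_step = Seq (SetReg 7 (NAdd (Reg 7) (NConst 1))) (SetReg 8 (NAdd (Reg 8) (NAdd (Reg 0) (NConst 1))))"

definition search_init :: com where
  "search_init = seqs [FPut 3 (Reg 3) (FAdd (FGet 3 (Reg 5)) (FGet 4 (NConst 0))),
     SetReg 7 (NConst 0), SetReg 8 (NConst 0)]"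

definition search_code :: com where
  "search_code = Seq search_init
     (While (BNot (FEq (FGet 3 (Reg 7)) (FGet 3 (Reg 3)))) search_step)"

definition insert_code :: com where
  "insert_code = seqs
     [Cond (NLess (Reg 7) (Reg 3)) Skip
        (Seq (SetReg 3 (NAdd (Reg 3) (NConst 1))) (SetReg 4 (NAdd (Reg 4) (NAdd (Reg 0) (NConst 1))))),
      Cond (NLess (NAdd (Reg 2) (NConst 1)) (Reg 12))
        (Seq (FPut 4 (NConst 1) FOne) (FPut 4 (NConst 2) FOne))
        (Seq (FPut 4 (NConst 1) (FDiv FOne (FSub (FGet 3 (Reg 5)) (FGet 1 (NConst 0)))))
             (FPut 4 (NConst 2) (FDiv FOne (FSub (FGet 3 (Reg 7)) (FGet 1 (NConst 0))))))]"

definition next_sum :: com where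
  "next_sum = Seq (SetReg 5 (NAdd (Reg 5) (NConst 1))) (SetReg 11 (NAdd (Reg 11) (NAdd (Reg 0) (NConst 1))))"

definition sum_code :: com where
  "sum_code = Seq search_code (Seq insert_code (Seq branches_code next_sum))"

definition layer_init :: com where
  "layer_init = seqs [SetReg 13 (NGet 0 (Reg 2)),
     Cond (NLess (Reg 13) (Reg 0)) (FPut 4 (NConst 0) (FGet 0 (Reg 13))) (FPut 4 (NConst 0) FZero),
     SetReg 5 (NConst 0), SetReg 11 (NConst 0), SetReg 6 (Reg 3)]"

definition next_layer :: com where
  "next_layer = Seq (SetReg 2 (NAdd (Reg 2) (NConst 1))) (NPut 1 (Reg 2) (Reg 4))"

definition layer_code :: com where
  "layer_code = Seq layer_init (Seq (While (NLess (Reg 5) (Reg 6)) sum_code) next_layer)"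

definition program_init :: com where
  "program_init = seqs [SetReg 12 (NAdd (Reg 0) (NAdd (Reg 0) (NConst 1))), SetReg 3 (NConst 1),
     SetReg 4 (NAdd (Reg 0) (NConst 1))]"

definition program_end :: com where
  "program_end = Seq (NPut 1 (NConst 0) (NConst 1)) (NPut 1 (Reg 12) (NConst 1))"

definition refutation_program :: com where
  "refutation_program = Seq program_init (Seq (While (NLess (Reg 2) (Reg 12)) layer_code) program_end)"

lemmas program_defs = emit_def put_coeffs_def NEqual_def label_code_def vertex_code_def branch_code_def
  search_step_def search_init_def insert_code_def next_sum_def layer_init_def next_layer_def
  program_init_def program_end_def

lemma loop_free_code:
  "loop_free branch_code" "loop_free search_step" "loop_free search_init" "loop_free insert_code"
  "loop_free next_sum" "loop_free layer_init" "loop_free next_layer" "loop_free program_init" "loop_free program_end"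
  by (simp_all add: program_defs)

lemma max_cost_code:
  "max_cost branch_code \<le> 300" "max_cost search_step \<le> 300" "max_cost search_init \<le> 300" "max_cost insert_code \<le> 300"
  "max_cost next_sum \<le> 300" "max_cost layer_init \<le> 300" "max_cost next_layer \<le> 300" "max_cost program_init \<le> 300"
  "max_cost program_end \<le> 300"
  by (simp_all add: program_defs)

lemma effect_emit:
  assumes "r \<noteq> 1"
  shows "reg (effect (emit r x k w) s) = (reg s)(1 := Suc (reg s 1))"
    and "narr (effect (emit r x k w) s) 0 = narr s 0"
    and "narr (effect (emit r x k w) s) (Suc 0) = narr s (Suc 0)"
    and "a \<noteq> 2 \<Longrightarrow> farr (effect (emit r x k w) s) a = farr s a"
    and "output_items (effect (emit r x k w) s) =
      output_items s @ [(reg s 2, reg s 10, reg s r, x, farr s 5 k * farr s 4 w)]"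
  by (simp_all add: emit_def output_items_def)

lemma effect_vertex_code:
  "reg (effect vertex_code s) = (reg s)(10 := (if reg s 2 = 0 then 0 else reg s 11 + reg s 9),
     14 := (if Suc (reg s 2) < reg s 12 then reg s 11 + reg s 9 else 0),
     15 := (if Suc (reg s 2) < reg s 12 then reg s 8 + reg s 9 else 0))"
  "narr (effect vertex_code s) = narr s" "farr (effect vertex_code s) = farr s"
  "output_items (effect vertex_code s) = output_items s"
  by (auto simp: vertex_code_def fun_eq_iff)

lemma effect_label_code_frame:
  "reg (effect label_code s) = reg s"
  "narr (effect label_code s) = narr s" "a \<noteq> 5 \<Longrightarrow> farr (effect label_code s) a = farr s a"
  "output_items (effect label_code s) = output_items s"
  by (auto simp: label_code_def put_coeffs_def NEqual_def)

lemma effect_label_code: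
  assumes "reg s 0 = n" "reg s 9 = j" "reg s 13 = var_code n v" "v \<in> ips_vars n" "farr s 4 0 = addend \<alpha> v"
  shows "farr (effect label_code s) 5 0 = coeff (stay \<alpha> j v) 0"
    "farr (effect label_code s) 5 (Suc 0) = coeff (stay \<alpha> j v) 1"
    "farr (effect label_code s) 5 2 = coeff (move \<alpha> j v) 0"
    "farr (effect label_code s) 5 3 = coeff (move \<alpha> j v) 1"
  using assms
  by (cases v; auto simp: label_code_def put_coeffs_def NEqual_def ips_vars_def)+

definition input_ok :: "nat \<Rightarrow> (nat \<Rightarrow> 'a::field) \<Rightarrow> 'a \<Rightarrow> ipsvar list \<Rightarrow> 'a state \<Rightarrow> bool" where
  "input_ok n \<alpha> \<beta> vs s \<longleftrightarrow> reg s 0 = n \<and> reg s 12 = length vs \<and>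
     (\<forall>i<length vs. narr s 0 i = var_code n (vs ! i)) \<and> (\<forall>i<n. farr s 0 i = \<alpha> i) \<and> farr s 1 0 = \<beta>"

lemma input_ok_frame:
  assumes "frame R F s s'" "input_ok n \<alpha> \<beta> vs s" "0 \<notin> R" "12 \<notin> R" "0 \<notin> F" "1 \<notin> F"
  shows "input_ok n \<alpha> \<beta> vs s'"
  using assms by (simp add: frame_def input_ok_def)

definition layer_ok :: "(nat \<Rightarrow> 'a::field) \<Rightarrow> ipsvar list \<Rightarrow> nat \<Rightarrow> nat \<Rightarrow> 'a state \<Rightarrow> bool" where
  "layer_ok \<alpha> vs n l s \<longleftrightarrow> reg s 2 = l \<and> reg s 13 = var_code n (vs ! l) \<and> farr s 4 0 = addend \<alpha> (vs ! l)"

lemma effect_branch_code: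
  fixes \<alpha> vs l p
  defines "ys \<equiv> partial_sums \<alpha> (take (Suc l) vs)"
  defines "b \<equiv> ys ! p + addend \<alpha> (vs ! l)"
  assumes "input_ok n \<alpha> \<beta> vs s" "set vs \<subseteq> ips_vars n" "l < length vs" "layer_ok \<alpha> vs n l s"
    "reg s 9 = j" "reg s 11 = p * Suc n" "reg s 8 = pos ys b * Suc n"
    "farr s 4 1 = final_weight \<beta> (length vs) (Suc l) (ys ! p)" "farr s 4 2 = final_weight \<beta> (length vs) (Suc l) b"
  shows "frame {1, 9, 10, 14, 15} {2, 5} s (effect branch_code s)"
    "reg (effect branch_code s) 9 = Suc j"
    "output_items (effect branch_code s) = output_items s @ edge_items n \<alpha> \<beta> vs l p j"
proof -
  have v: "vs ! l \<in> ips_vars n" using assms by auto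
  have regs: "reg s 0 = n" "reg s 9 = j" "reg s 13 = var_code n (vs ! l)" "farr s 4 0 = addend \<alpha> (vs ! l)"
    using assms by (auto simp: input_ok_def layer_ok_def)
  note lab = effect_label_code[OF regs(1-3) v regs(4)]
  show "frame {1, 9, 10, 14, 15} {2, 5} s (effect branch_code s)"
    by (simp add: frame_def branch_code_def effect_emit effect_vertex_code effect_label_code_frame)
  show "reg (effect branch_code s) 9 = Suc j"
    using regs by (simp add: branch_code_def effect_emit effect_vertex_code effect_label_code_frame)
  define v where "v = vs ! l"
  have items: "edge_items n \<alpha> \<beta> vs l p j =
     [(l, vertex n (length vs) l p j, vertex n (length vs) (Suc l) p j, 0,
        coeff (stay \<alpha> j v) 0 * final_weight \<beta> (length vs) (Suc l) (ys ! p)),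
      (l, vertex n (length vs) l p j, vertex n (length vs) (Suc l) p j, 1,
        coeff (stay \<alpha> j v) 1 * final_weight \<beta> (length vs) (Suc l) (ys ! p)),
      (l, vertex n (length vs) l p j, vertex n (length vs) (Suc l) (pos ys b) j, 0,
        coeff (move \<alpha> j v) 0 * final_weight \<beta> (length vs) (Suc l) b),
      (l, vertex n (length vs) l p j, vertex n (length vs) (Suc l) (pos ys b) j, 1,
        coeff (move \<alpha> j v) 1 * final_weight \<beta> (length vs) (Suc l) b)]"
    by (simp add: edge_items_def Let_def v_def ys_def b_def)
  have l: "l \<noteq> length vs" "Suc l < length vs \<longleftrightarrow> Suc l \<noteq> length vs" using assms by auto
  show "output_items (effect branch_code s) = output_items s @ edge_items n \<alpha> \<beta> vs l p j"
    using assms(3,6-) l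
    by (simp add: branch_code_def effect_emit effect_vertex_code effect_label_code_frame lab[folded v_def]
        items vertex_def input_ok_def layer_ok_def)
qed

lemma runs_branches_code:
  fixes \<alpha> vs l p
  defines "ys \<equiv> partial_sums \<alpha> (take (Suc l) vs)"
  defines "b \<equiv> ys ! p + addend \<alpha> (vs ! l)"
  assumes "input_ok n \<alpha> \<beta> vs s" "set vs \<subseteq> ips_vars n" "l < length vs" "layer_ok \<alpha> vs n l s"
    "reg s 11 = p * Suc n" "reg s 8 = pos ys b * Suc n"
    "farr s 4 1 = final_weight \<beta> (length vs) (Suc l) (ys ! p)" "farr s 4 2 = final_weight \<beta> (length vs) (Suc l) b"
  shows "runs branches_code s (Suc n * 400 + 100) (\<lambda>s'. frame {1, 9, 10, 14, 15} {2, 5} s s' \<and>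
    output_items s' = output_items s @ sum_items n \<alpha> \<beta> vs l p)"
proof -
  let ?I = "\<lambda>j s'. frame {1, 9, 10, 14, 15} {2, 5} s s' \<and> reg s' 9 = j \<and>
    output_items s' = output_items s @ concat (map (edge_items n \<alpha> \<beta> vs l p) [0..<j])"
  let ?b = "NLess (Reg 9) (NAdd (Reg 0) (NConst 1))"
  let ?s = "effect (SetReg 9 (NConst 0)) s"
  have init: "?I 0 ?s"
    by (simp add: frame_def)
  have "runs (While ?b branch_code) ?s (Suc n * (1 + bcost ?b + 300) + (1 + bcost ?b)) (?I (Suc n))"
  proof (rule runs_While[where I = ?I])
    fix j s' assume j: "j < Suc n" and I: "?I j s'"
    have "input_ok n \<alpha> \<beta> vs s'" using I assms(3) by (auto elim: input_ok_frame)
    moreover have "layer_ok \<alpha> vs n l s'" using I assms(6) by (simp add: layer_ok_def frame_def)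
    moreover have "reg s' 11 = p * Suc n" "reg s' 8 = pos ys b * Suc n"
      "farr s' 4 1 = final_weight \<beta> (length vs) (Suc l) (ys ! p)" "farr s' 4 2 = final_weight \<beta> (length vs) (Suc l) b"
      using I assms(7-) by (simp_all add: frame_def)
    ultimately have step: "frame {1, 9, 10, 14, 15} {2, 5} s' (effect branch_code s')"
      "reg (effect branch_code s') 9 = Suc j"
      "output_items (effect branch_code s') = output_items s' @ edge_items n \<alpha> \<beta> vs l p j"
      using effect_branch_code[of n \<alpha> \<beta> vs s' l j p] assms(4,5) I unfolding ys_def b_def by auto
    have "?I (Suc j) (effect branch_code s')"
      using step I frame_trans[OF conjunct1[OF I] step(1)] by simp
    then have "runs branch_code s' 300 (?I (Suc j))"
      by (intro runs_code loop_free_code max_cost_code)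
    moreover have "reg s' 0 = n" using I assms(3) by (simp add: frame_def input_ok_def)
    ultimately show "bval ?b s' \<and> runs branch_code s' 300 (?I (Suc j))" using I j by simp
  next
    fix s' assume "?I (Suc n) s'"
    then show "\<not> bval ?b s'" using assms(3) by (simp add: frame_def input_ok_def)
  qed (fact init)
  then have "runs branches_code s (max_cost (SetReg 9 (NConst 0)) + (Suc n * (1 + bcost ?b + 300) + (1 + bcost ?b))) (?I (Suc n))"
    unfolding branches_code_def
    by (intro runs_Seq[OF runs_effect[where Q = "\<lambda>s'. s' = ?s"]]) auto
  then show ?thesis
    by (rule runs_mono) (auto simp: sum_items_def)
qed

lemma nth_stored_sums: "i < reg s 3 \<Longrightarrow> stored_sums s ! i = farr s 3 i"
  by (simp add: stored_sums_def)

lemma stored_sums_update [simp]: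
  "r 3 = reg s 3 \<Longrightarrow> stored_sums (s\<lparr>reg := r\<rparr>) = stored_sums s"
  by (simp add: stored_sums_def)

lemma length_stored_sums [simp]: "length (stored_sums s) = reg s 3"
  by (simp add: stored_sums_def)

lemma runs_search_code:
  fixes s :: "'a::field state"
  defines "ys \<equiv> stored_sums s" and "p \<equiv> reg s 5" and "n \<equiv> reg s 0"
  defines "b \<equiv> ys ! p + farr s 4 0"
  assumes p: "p < length ys" and a: "length ys \<le> a"
  shows "runs search_code s (a * 400 + 400) (\<lambda>s'. frame {7, 8} {3} s s' \<and>
    farr s' 3 = (farr s 3)(reg s 3 := b) \<and> reg s' 7 = pos (ys @ [b]) b \<and>
    reg s' 8 = pos (ys @ [b]) b * Suc n \<and> output_items s' = output_items s)"
proof -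
  let ?I = "\<lambda>i s'. frame {7, 8} {3} s s' \<and> farr s' 3 = (farr s 3)(reg s 3 := b) \<and> reg s' 7 = i \<and>
    reg s' 8 = i * Suc n \<and> output_items s' = output_items s"
  let ?b = "BNot (FEq (FGet 3 (Reg 7)) (FGet 3 (Reg 3)))" and ?M = "pos (ys @ [b]) b"
  let ?s = "effect search_init s"
  have M: "?M \<le> reg s 3" using pos_less[of b "ys @ [b]"] by (simp add: ys_def)
  have nth: "((farr s 3)(reg s 3 := b)) i = (ys @ [b]) ! i" if "i \<le> reg s 3" for i
    using that by (auto simp: ys_def nth_append nth_stored_sums)
  have init: "?I 0 ?s"
    using p by (simp add: search_init_def frame_def b_def ys_def p_def nth_stored_sums)
  have "runs (While ?b search_step) ?s (?M * (1 + bcost ?b + 300) + (1 + bcost ?b)) (?I ?M)"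
  proof (rule runs_While[where I = ?I])
    fix i s' assume i: "i < ?M" and I: "?I i s'"
    have "?I (Suc i) (effect search_step s')"
      using I by (simp add: search_step_def frame_def n_def)
    then have "runs search_step s' 300 (?I (Suc i))"
      by (intro runs_code loop_free_code max_cost_code)
    moreover have "bval ?b s'"
      using I nth[of i] nth_before_pos[OF i] i M by (auto simp: frame_def)
    ultimately show "bval ?b s' \<and> runs search_step s' 300 (?I (Suc i))" by blast
  next
    fix s' assume I: "?I ?M s'"
    then show "\<not> bval ?b s'"
      using nth[of ?M] M nth_pos[of b "ys @ [b]"] by (auto simp: frame_def)
  qed (fact init)
  then have "runs search_code s (300 + (?M * (1 + bcost ?b + 300) + (1 + bcost ?b))) (?I ?M)"
    unfolding search_code_def
    by (intro runs_Seq[OF runs_code[where Q = "\<lambda>s'. s' = ?s"]] loop_free_code max_cost_code) auto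
  then show ?thesis
  proof (rule runs_mono)
    have "?M * 400 \<le> a * 400" using M a by (simp add: ys_def)
    then show "300 + (?M * (1 + bcost ?b + 300) + (1 + bcost ?b)) \<le> a * 400 + 400" by simp
  qed auto
qed

lemma pos_snoc_less_iff: "pos (ys @ [b]) b < length ys \<longleftrightarrow> b \<in> set ys"
  by (induction ys) (auto simp: pos_def)

lemma effect_insert_code:
  fixes s :: "'a::field state"
  defines "ys \<equiv> stored_sums s" and "s' \<equiv> effect insert_code s"
  assumes "reg s 7 = pos (ys @ [b]) b" "farr s 3 (reg s 3) = b" "reg s 4 = reg s 3 * Suc n" "reg s 0 = n"
    "reg s 5 < length ys" "reg s 2 < reg s 12"
  shows "frame {3, 4} {4} s s'" "stored_sums s' = insert_new ys b" "reg s' 4 = reg s' 3 * Suc n"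
    "farr s' 4 0 = farr s 4 0" "output_items s' = output_items s"
    "farr s' 4 1 = final_weight (farr s 1 0) (reg s 12) (Suc (reg s 2)) (ys ! reg s 5)"
    "farr s' 4 2 = final_weight (farr s 1 0) (reg s 12) (Suc (reg s 2)) b"
proof -
  have b: "farr s 3 (reg s 7) = b"
  proof (cases "reg s 7 < reg s 3")
    case True
    then have "farr s 3 (reg s 7) = (ys @ [b]) ! reg s 7"
      by (simp add: ys_def nth_append nth_stored_sums)
    then show ?thesis using nth_pos[of b "ys @ [b]"] assms(3) by simp
  next
    case False
    then have "reg s 7 = reg s 3" using pos_less[of b "ys @ [b]"] assms(3) by (simp add: ys_def)
    then show ?thesis using assms(4) by simp
  qed
  have less: "reg s 7 < reg s 3 \<longleftrightarrow> b \<in> set ys"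
    using pos_snoc_less_iff[of ys b] assms(3) by (simp add: ys_def)
  have a: "farr s 3 (reg s 5) = ys ! reg s 5"
    using assms(7) by (simp add: ys_def nth_stored_sums)
  have last: "Suc (reg s 2) < reg s 12 \<longleftrightarrow> Suc (reg s 2) \<noteq> reg s 12" using assms(8) by auto
  show "frame {3, 4} {4} s s'" "farr s' 4 0 = farr s 4 0" "output_items s' = output_items s"
    by (auto simp: s'_def insert_code_def frame_def)
  show "farr s' 4 1 = final_weight (farr s 1 0) (reg s 12) (Suc (reg s 2)) (ys ! reg s 5)"
    "farr s' 4 2 = final_weight (farr s 1 0) (reg s 12) (Suc (reg s 2)) b"
    using a b last by (auto simp: s'_def insert_code_def final_weight_def)
  have m: "reg s' 3 = (if b \<in> set ys then reg s 3 else Suc (reg s 3))" "farr s' 3 = farr s 3"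
    using less by (auto simp: s'_def insert_code_def)
  then show "stored_sums s' = insert_new ys b"
    using assms(4) by (auto simp: insert_new_def stored_sums_def ys_def)
  show "reg s' 4 = reg s' 3 * Suc n"
    using less assms(5,6) by (auto simp: s'_def insert_code_def)
qed

lemma runs_sum_code:
  fixes \<alpha> vs l s
  defines "ys \<equiv> stored_sums s" and "p \<equiv> reg s 5"
  defines "b \<equiv> ys ! p + addend \<alpha> (vs ! l)"
  assumes inp: "input_ok n \<alpha> \<beta> vs s" and vs: "set vs \<subseteq> ips_vars n" and l: "l < length vs"
    and lay: "layer_ok \<alpha> vs n l s"
    and p: "p < length ys" "reg s 11 = p * Suc n" and m: "reg s 4 = reg s 3 * Suc n" and a: "length ys \<le> a"
    and prefix: "partial_sums \<alpha> (take (Suc l) vs) = insert_new ys b @ zs"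
  shows "runs sum_code s (a * 400 + Suc n * 400 + 2000)
    (\<lambda>s'. frame {1, 3, 4, 5, 7, 8, 9, 10, 11, 14, 15} {2, 3, 4, 5} s s' \<and> farr s' 4 0 = farr s 4 0 \<and>
      stored_sums s' = insert_new ys b \<and> reg s' 4 = reg s' 3 * Suc n \<and> reg s' 5 = Suc p \<and>
      reg s' 11 = Suc p * Suc n \<and> output_items s' = output_items s @ sum_items n \<alpha> \<beta> vs l p)"
proof -
  let ?ys = "partial_sums \<alpha> (take (Suc l) vs)"
  have yp: "?ys ! p = ys ! p"
    using p(1) unfolding prefix by (auto simp: insert_new_def nth_append)
  have pos: "pos ?ys b = pos (ys @ [b]) b"
    unfolding prefix by (subst pos_append) (auto simp: insert_new_def pos_append)
  have regs: "reg s 0 = n" "reg s 12 = length vs" "reg s 2 = l" "farr s 1 0 = \<beta>" "farr s 4 0 = addend \<alpha> (vs ! l)"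
    using inp lay by (auto simp: input_ok_def layer_ok_def)
  let ?R = "{1, 3, 4, 5, 7, 8, 9, 10, 11, 14, 15}" and ?F = "{2, 3, 4, 5} :: nat set"
  let ?Q = "\<lambda>s'. frame ?R ?F s s' \<and> farr s' 4 0 = farr s 4 0 \<and>
      stored_sums s' = insert_new ys b \<and> reg s' 4 = reg s' 3 * Suc n \<and> reg s' 5 = Suc p \<and>
      reg s' 11 = Suc p * Suc n \<and> output_items s' = output_items s @ sum_items n \<alpha> \<beta> vs l p"
  have "runs sum_code s ((a * 400 + 400) + (300 + ((Suc n * 400 + 100) + 300))) ?Q"
    unfolding sum_code_def
  proof (rule runs_Seq)
    show "runs search_code s (a * 400 + 400) (\<lambda>s'. frame {7, 8} {3} s s' \<and>
      farr s' 3 = (farr s 3)(reg s 3 := b) \<and> reg s' 7 = pos (ys @ [b]) b \<and>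
      reg s' 8 = pos (ys @ [b]) b * Suc n \<and> output_items s' = output_items s)"
      using runs_search_code[of s a] p(1) a regs unfolding ys_def p_def b_def by simp
    fix s1 assume s1: "frame {7, 8} {3} s s1 \<and>
      farr s1 3 = (farr s 3)(reg s 3 := b) \<and> reg s1 7 = pos (ys @ [b]) b \<and>
      reg s1 8 = pos (ys @ [b]) b * Suc n \<and> output_items s1 = output_items s"
    let ?s2 = "effect insert_code s1"
    have ys1: "stored_sums s1 = ys"
      using s1 by (auto simp: stored_sums_def ys_def frame_def)
    have regs1: "reg s1 0 = n" "reg s1 12 = length vs" "reg s1 2 = l" "farr s1 1 0 = \<beta>"
        "farr s1 4 0 = addend \<alpha> (vs ! l)" "reg s1 5 = p" "reg s1 11 = p * Suc n" "reg s1 13 = reg s 13"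
      using s1 regs p by (simp_all add: frame_def p_def)
    have ins: "frame {3, 4} {4} s1 ?s2" "stored_sums ?s2 = insert_new ys b" "reg ?s2 4 = reg ?s2 3 * Suc n"
      "farr ?s2 4 0 = farr s1 4 0" "output_items ?s2 = output_items s1"
      "farr ?s2 4 1 = final_weight \<beta> (length vs) (Suc l) (ys ! p)"
      "farr ?s2 4 2 = final_weight \<beta> (length vs) (Suc l) b"
      using effect_insert_code[of s1 b n] s1 regs1 m p(1) l unfolding ys1 by (simp_all add: frame_def)
    have fr2: "frame ?R ?F s ?s2"
      using s1 by (intro frame_trans[OF _ ins(1), of "{7, 8}" "{3}"]) auto
    have "runs (Seq branches_code next_sum) ?s2 ((Suc n * 400 + 100) + 300) ?Q"
    proof (rule runs_Seq)
      show "runs branches_code ?s2 (Suc n * 400 + 100) (\<lambda>s'. frame {1, 9, 10, 14, 15} {2, 5} ?s2 s' \<and>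
        output_items s' = output_items ?s2 @ sum_items n \<alpha> \<beta> vs l p)"
      proof (rule runs_branches_code)
        show "input_ok n \<alpha> \<beta> vs ?s2" using fr2 inp by (rule input_ok_frame) auto
        show "layer_ok \<alpha> vs n l ?s2"
          using fr2 lay ins(4) regs1 by (simp add: layer_ok_def frame_def)
        show "reg ?s2 11 = p * Suc n" using ins(1) regs1 by (simp add: frame_def)
        show "reg ?s2 8 = pos ?ys (?ys ! p + addend \<alpha> (vs ! l)) * Suc n"
          using ins(1) s1 unfolding yp b_def[symmetric] pos by (simp add: frame_def)
      qed (use vs l ins(6,7) in \<open>simp_all add: yp b_def\<close>)
      fix s3 assume s3: "frame {1, 9, 10, 14, 15} {2, 5} ?s2 s3 \<and>
        output_items s3 = output_items ?s2 @ sum_items n \<alpha> \<beta> vs l p"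
      have fr3: "frame ?R ?F s s3"
        using s3 by (intro frame_trans[OF fr2, of "{1, 9, 10, 14, 15}" "{2, 5}"]) auto
      have s3': "reg s3 0 = n" "reg s3 5 = p" "reg s3 11 = p * Suc n" "reg s3 4 = reg s3 3 * Suc n"
          "farr s3 4 0 = farr s 4 0" "farr s3 3 = farr ?s2 3" "reg s3 3 = reg ?s2 3"
        using s3 ins(1,3,4) regs1 regs by (simp_all add: frame_def)
      have "stored_sums s3 = insert_new ys b"
        using s3' ins(2) by (simp add: stored_sums_def)
      then have "?Q (effect next_sum s3)"
        using fr3 s3 s3' ins(5) s1 by (simp add: next_sum_def frame_def)
      then show "runs next_sum s3 300 ?Q"
        by (intro runs_code loop_free_code max_cost_code)
    qed
    then show "runs (Seq insert_code (Seq branches_code next_sum)) s1 (300 + ((Suc n * 400 + 100) + 300)) ?Q"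
      by (intro runs_Seq[OF runs_code[where Q = "\<lambda>s'. s' = ?s2"]] loop_free_code max_cost_code) auto
  qed
  then show ?thesis by (rule runs_mono) auto
qed

lemma runs_layer_code:
  fixes \<alpha> :: "nat \<Rightarrow> 'a::field"
  defines "S \<equiv> \<lambda>l vs. partial_sums \<alpha> (take l vs)"
  assumes inp: "input_ok n \<alpha> \<beta> vs s" and vs: "set vs \<subseteq> ips_vars n" and l: "l < length vs"
    and s: "reg s 2 = l" "stored_sums s = S l vs" "reg s 4 = reg s 3 * Suc n"
    and a: "length (S (Suc l) vs) \<le> a"
  shows "runs layer_code s (a * (a * 400 + Suc n * 400 + 2010) + 1000)
    (\<lambda>s'. input_ok n \<alpha> \<beta> vs s' \<and> reg s' 2 = Suc l \<and> stored_sums s' = S (Suc l) vs \<and> reg s' 4 = reg s' 3 * Suc n \<and>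
      narr s' 1 = (narr s 1)(Suc l := length (S (Suc l) vs) * Suc n) \<and>
      output_items s' = output_items s @ layer_items n \<alpha> \<beta> vs l)" (is "runs _ _ _ ?Q")
proof -
  let ?xs = "S l vs" and ?ad = "addend \<alpha> (vs ! l)"
  define F where "F i = fold (\<lambda>x ys. insert_new ys (x + ?ad)) (take i ?xs) ?xs" for i
  have S_Suc: "S (Suc l) vs = F (length ?xs)"
    using partial_sums_take_Suc[OF l] by (simp add: S_def F_def add_shifted_def)
  have F_Suc: "F (Suc i) = insert_new (F i) (?xs ! i + ?ad)" if "i < length ?xs" for i
    using that by (simp add: F_def take_Suc_conv_app_nth)
  have F_prefix: "\<exists>zs. S (Suc l) vs = F i @ zs" for i
  proof -
    have "S (Suc l) vs = fold (\<lambda>x ys. insert_new ys (x + ?ad)) (take i ?xs @ drop i ?xs) ?xs"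
      by (simp add: S_Suc F_def)
    also have "\<dots> = fold (\<lambda>x ys. insert_new ys (x + ?ad)) (drop i ?xs) (F i)"
      by (simp only: fold_append o_apply F_def)
    finally show ?thesis using fold_insert_new_prefix by metis
  qed
  have F_nth: "F i ! k = ?xs ! k" "k < length (F i)" if "k < length ?xs" for i k
  proof -
    obtain zs where "F i = ?xs @ zs" unfolding F_def
      using fold_insert_new_prefix[of "\<lambda>x. x + ?ad" "take i ?xs" ?xs] by blast
    then show "F i ! k = ?xs ! k" "k < length (F i)" using that by (auto simp: nth_append)
  qed
  have F_le: "length (F i) \<le> a" for i
    using F_prefix[of i] a by auto
  have len: "length ?xs = reg s 3" using s(2) by (metis length_stored_sums)
  let ?s1 = "effect layer_init s"
  have s1: "frame {5, 6, 11, 13} {4} s ?s1" "layer_ok \<alpha> vs n l ?s1" "reg ?s1 5 = 0" "reg ?s1 11 = 0"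
    "reg ?s1 6 = reg s 3" "stored_sums ?s1 = ?xs" "output_items ?s1 = output_items s"
  proof -
    have "vs ! l \<in> ips_vars n" using vs l by auto
    then show "layer_ok \<alpha> vs n l ?s1"
      using inp l s(1) by (cases "vs ! l") (auto simp: layer_ok_def layer_init_def input_ok_def ips_vars_def)
  qed (use s in \<open>auto simp: layer_init_def frame_def stored_sums_def\<close>)
  let ?R = "{1, 3, 4, 5, 7, 8, 9, 10, 11, 14, 15} :: nat set" and ?F = "{2, 3, 4, 5} :: nat set"
  let ?I = "\<lambda>i s'. frame ?R ?F ?s1 s' \<and> farr s' 4 0 = farr ?s1 4 0 \<and> stored_sums s' = F i \<and>
     reg s' 4 = reg s' 3 * Suc n \<and> reg s' 5 = i \<and> reg s' 11 = i * Suc n \<and>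
     output_items s' = output_items ?s1 @ concat (map (sum_items n \<alpha> \<beta> vs l) [0..<i])"
  let ?b = "NLess (Reg 5) (Reg 6)" and ?t = "a * 400 + Suc n * 400 + 2000"
  have inp1: "input_ok n \<alpha> \<beta> vs ?s1"
    using s1(1) inp by (rule input_ok_frame) auto
  have "runs (While ?b sum_code) ?s1 (length ?xs * (1 + bcost ?b + ?t) + (1 + bcost ?b)) (?I (length ?xs))"
  proof (rule runs_While[where I = ?I])
    show "?I 0 ?s1"
      using s1 s(3) by (simp add: frame_def F_def)
  next
    fix i s' assume i: "i < length ?xs" and I: "?I i s'"
    obtain zs where zs: "S (Suc l) vs = insert_new (F i) (F i ! i + ?ad) @ zs"
      using F_prefix[of "Suc i"] F_Suc[OF i] F_nth(1)[OF i] by metis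
    have "runs sum_code s' ?t
      (\<lambda>s''. frame ?R ?F s' s'' \<and> farr s'' 4 0 = farr s' 4 0 \<and>
      stored_sums s'' = insert_new (stored_sums s') (stored_sums s' ! reg s' 5 + ?ad) \<and>
      reg s'' 4 = reg s'' 3 * Suc n \<and> reg s'' 5 = Suc (reg s' 5) \<and>
      reg s'' 11 = Suc (reg s' 5) * Suc n \<and> output_items s'' = output_items s' @ sum_items n \<alpha> \<beta> vs l (reg s' 5))"
    proof (rule runs_sum_code)
      show "input_ok n \<alpha> \<beta> vs s'" using I inp1 by (auto elim: input_ok_frame)
      show "layer_ok \<alpha> vs n l s'" using I s1(2) by (simp add: layer_ok_def frame_def)
      show "reg s' 5 < length (stored_sums s')" using I F_nth(2)[OF i, of i] by metis
      show "reg s' 11 = reg s' 5 * Suc n" "reg s' 4 = reg s' 3 * Suc n" using I by auto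
      show "length (stored_sums s') \<le> a" using I F_le[of i] by metis
      show "partial_sums \<alpha> (take (Suc l) vs) = insert_new (stored_sums s') (stored_sums s' ! reg s' 5 + ?ad) @ zs"
        using zs I by (simp add: S_def)
    qed (use vs l in auto)
    then have "runs sum_code s' ?t (?I (Suc i))"
    proof (rule runs_mono)
      fix s'' assume s'': "frame ?R ?F s' s'' \<and> farr s'' 4 0 = farr s' 4 0 \<and>
        stored_sums s'' = insert_new (stored_sums s') (stored_sums s' ! reg s' 5 + ?ad) \<and>
        reg s'' 4 = reg s'' 3 * Suc n \<and> reg s'' 5 = Suc (reg s' 5) \<and>
        reg s'' 11 = Suc (reg s' 5) * Suc n \<and> output_items s'' = output_items s' @ sum_items n \<alpha> \<beta> vs l (reg s' 5)"
      have "frame ?R ?F ?s1 s''" using I s'' by (blast intro: frame_trans)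
      moreover have "stored_sums s'' = F (Suc i)"
        using s'' I F_Suc[OF i] F_nth(1)[OF i] by metis
      ultimately show "?I (Suc i) s''" using I s'' by simp
    qed simp
    then show "bval ?b s' \<and> runs sum_code s' ?t (?I (Suc i))"
      using I i s1(5) len by (simp add: frame_def)
  next
    fix s' assume "?I (length ?xs) s'"
    then show "\<not> bval ?b s'" using s1(5) len by (simp add: frame_def)
  qed
  moreover have "?Q (effect next_layer s')" if I: "?I (length ?xs) s'" for s'
  proof -
    have fr: "frame ?R ?F ?s1 s'" using I by blast
    have inp': "input_ok n \<alpha> \<beta> vs s'" using fr inp1 by (rule input_ok_frame) auto
    have l2: "reg s' 2 = l" using fr s1(2) by (simp add: layer_ok_def frame_def)
    have S': "stored_sums s' = S (Suc l) vs" using I S_Suc by metis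
    then have r3: "reg s' 3 = length (S (Suc l) vs)" by (metis length_stored_sums)
    have n1: "narr s' 1 = narr s 1" using fr s1(1) by (simp add: frame_def)
    have out: "output_items s' = output_items s @ layer_items n \<alpha> \<beta> vs l"
      using I s1(7) unfolding layer_items_def S_def by simp
    have "input_ok n \<alpha> \<beta> vs (effect next_layer s')"
      using inp' by (simp add: next_layer_def input_ok_def)
    moreover have "stored_sums (effect next_layer s') = S (Suc l) vs"
      using S' by (simp add: next_layer_def stored_sums_def)
    ultimately show ?thesis
      using l2 n1 r3 out I by (simp add: next_layer_def)
  qed
  ultimately have "runs layer_code s (300 + ((length ?xs * (1 + bcost ?b + ?t) + (1 + bcost ?b)) + 300)) ?Q"
    unfolding layer_code_def
    by (intro runs_between loop_free_code max_cost_code)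
  then show ?thesis
  proof (rule runs_mono)
    have "length ?xs \<le> a" using F_le[of 0] by (simp add: F_def)
    then have "length ?xs * (?t + 10) \<le> a * (?t + 10)" by (rule mult_right_mono) simp
    then show "300 + ((length ?xs * (1 + bcost ?b + ?t) + (1 + bcost ?b)) + 300)
      \<le> a * (a * 400 + Suc n * 400 + 2010) + 1000"
      by (simp add: algebra_simps)
  qed
qed

lemma runs_refutation_program:
  fixes \<alpha> :: "nat \<Rightarrow> 'a::field"
  assumes vo: "variable_order n vs" and a: "a = card (subset_sums n \<alpha>)"
  shows "runs refutation_program (input_state n \<alpha> \<beta> vs)
    ((2 * n + 1) * (a * (a * 400 + Suc n * 400 + 2010) + 1010) + 1000)
    (\<lambda>s. output_roabp s = refutation_roabp n \<alpha> \<beta> vs)" (is "runs _ ?s0 _ ?Q")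
proof -
  have vs: "distinct vs" "set vs = ips_vars n" and N: "length vs = 2 * n + 1"
    using vo length_variable_order by (auto simp: variable_order_def)
  let ?S = "\<lambda>l. partial_sums \<alpha> (take l vs)"
  have len: "length (?S l) \<le> a" for l
    unfolding a by (rule length_partial_sums) (use vs set_take_subset[of l vs] in auto)
  let ?I = "\<lambda>l s. input_ok n \<alpha> \<beta> vs s \<and> reg s 2 = l \<and> stored_sums s = ?S l \<and> reg s 4 = reg s 3 * Suc n \<and>
    narr s 1 = (\<lambda>i. if 0 < i \<and> i \<le> l then length (?S i) * Suc n else 0) \<and>
    output_items s = concat (map (layer_items n \<alpha> \<beta> vs) [0..<l])"
  let ?b = "NLess (Reg 2) (Reg 12)" and ?t = "a * (a * 400 + Suc n * 400 + 2010) + 1000"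
  let ?s1 = "effect program_init ?s0"
  have "runs (While ?b layer_code) ?s1 (length vs * (1 + bcost ?b + ?t) + (1 + bcost ?b)) (?I (length vs))"
  proof (rule runs_While[where I = ?I])
    have "output_items ?s1 = []" "stored_sums ?s1 = [0]"
      by (simp_all add: output_items_def stored_sums_def program_init_def input_state_def)
    then show "?I 0 ?s1"
      using N by (auto simp: input_ok_def program_init_def input_state_def)
  next
    fix l s assume l: "l < length vs" and I: "?I l s"
    have "runs layer_code s ?t
      (\<lambda>s'. input_ok n \<alpha> \<beta> vs s' \<and> reg s' 2 = Suc l \<and> stored_sums s' = ?S (Suc l) \<and> reg s' 4 = reg s' 3 * Suc n \<and>
        narr s' 1 = (narr s 1)(Suc l := length (?S (Suc l)) * Suc n) \<and>
        output_items s' = output_items s @ layer_items n \<alpha> \<beta> vs l)"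
      by (rule runs_layer_code) (use I l vs len in auto)
    then have "runs layer_code s ?t (?I (Suc l))"
      by (rule runs_mono) (use I in \<open>auto simp: fun_eq_iff le_Suc_eq\<close>)
    then show "bval ?b s \<and> runs layer_code s ?t (?I (Suc l))"
      using I l by (simp add: input_ok_def)
  next
    fix s assume "?I (length vs) s"
    then show "\<not> bval ?b s" by (simp add: input_ok_def)
  qed
  moreover have "?Q (effect program_end s)" if I: "?I (length vs) s" for s
  proof -
    have "narr (effect program_end s) 1 = layer_size n \<alpha> vs"
      using I by (auto simp: fun_eq_iff program_end_def input_ok_def layer_size_def)
    moreover have "output_items (effect program_end s) = refutation_items n \<alpha> \<beta> vs"
      using I by (simp add: program_end_def refutation_items_def)
    ultimately show ?thesis
      by (simp add: output_roabp_eq refutation_roabp_def)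
  qed
  ultimately have "runs refutation_program ?s0 (300 + ((length vs * (1 + bcost ?b + ?t) + (1 + bcost ?b)) + 300)) ?Q"
    unfolding refutation_program_def
    by (intro runs_between loop_free_code max_cost_code)
  then show ?thesis
    by (rule runs_mono) (simp_all add: N algebra_simps)
qed

lemma time_le_poly_bound:
  assumes "0 < a"
  shows "(2 * n + 1) * (a * (a * 400 + Suc n * 400 + 2010) + 1010) + 1000 \<le> poly_bound a n"
proof -
  define T where "T = a + n + 2"
  have T: "3 \<le> T" "a \<le> T" "Suc n \<le> T" "2 * n + 1 \<le> 2 * T" using assms by (auto simp: T_def)
  have "a * 400 + Suc n * 400 + 2010 \<le> 1800 * T" using T by simp
  with T(2) have "a * (a * 400 + Suc n * 400 + 2010) \<le> T * (1800 * T)" by (rule mult_le_mono)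
  moreover have T2: "9 \<le> T ^ 2" using power_mono[OF T(1), of 2] by simp
  ultimately have "a * (a * 400 + Suc n * 400 + 2010) + 1010 \<le> 2000 * T ^ 2"
    by (simp add: power2_eq_square)
  with T(4) have "(2 * n + 1) * (a * (a * 400 + Suc n * 400 + 2010) + 1010) \<le> (2 * T) * (2000 * T ^ 2)"
    by (rule mult_le_mono)
  moreover have T3: "27 \<le> T ^ 3" using power_mono[OF T(1), of 3] by simp
  ultimately have "(2 * n + 1) * (a * (a * 400 + Suc n * 400 + 2010) + 1010) + 1000 \<le> 5000 * T ^ 3"
    by (simp add: power3_eq_cube power2_eq_square)
  also have "\<dots> \<le> T ^ 17 * T ^ 3"
    using power_mono[OF T(1), of 17] by (intro mult_right_mono) simp_all
  also have "\<dots> = poly_bound a n"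
    by (simp add: poly_bound_def T_def flip: power_add)
  finally show ?thesis .
qed

lemma roabp_computes_mono: "roabp_computes r vs B C \<Longrightarrow> r \<le> r' \<Longrightarrow> roabp_computes r' vs B C"
  unfolding roabp_computes_def is_roabp_def by (meson le_trans)

lemma width_le_poly_bound: "a * Suc n \<le> poly_bound a n"
proof -
  have "a * Suc n \<le> (a + n + 2) * (a + n + 2)" by (intro mult_le_mono) auto
  also have "\<dots> = (a + n + 2) ^ 2" by (simp only: power2_eq_square)
  also have "\<dots> \<le> (a + n + 2) ^ 20" by (rule power_increasing) auto
  finally show ?thesis by (simp add: poly_bound_def)
qed

theorem corollary4p19:
  shows "\<exists>P. \<forall>(n::nat) (\<alpha> :: nat \<Rightarrow> 'a::field) (\<beta> :: 'a).
    \<beta> \<notin> subset_sums n \<alpha> \<longrightarrow>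
    (\<exists>C. IPS_LIN_refutation n (subset_sum_poly n \<alpha> \<beta>) C \<and>
         individual_degree C \<le> 2 \<and>
         (\<forall>vs. variable_order n vs \<longrightarrow>
            (\<exists>B. roabp_computes (poly_bound (card (subset_sums n \<alpha>)) n) vs B C \<and>
                 constructs_within P (poly_bound (card (subset_sums n \<alpha>)) n) n \<alpha> \<beta> vs B)))"
proof (intro exI[of _ refutation_program] allI impI)
  fix n and \<alpha> :: "nat \<Rightarrow> 'a" and \<beta> :: 'a
  assume \<beta>: "\<beta> \<notin> subset_sums n \<alpha>"
  let ?a = "card (subset_sums n \<alpha>)" and ?C = "certificate n \<alpha> \<beta>"
  have a: "0 < ?a" by (auto simp: card_gt_0_iff subset_sums_eq)
  have "\<exists>B. roabp_computes (poly_bound ?a n) vs B ?C \<and>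
      constructs_within refutation_program (poly_bound ?a n) n \<alpha> \<beta> vs B" if "variable_order n vs" for vs
  proof (intro exI conjI)
    show "roabp_computes (poly_bound ?a n) vs (refutation_roabp n \<alpha> \<beta> vs) ?C"
      using refutation_roabp_computes[OF that] width_le_poly_bound by (rule roabp_computes_mono)
    have "runs refutation_program (input_state n \<alpha> \<beta> vs) (poly_bound ?a n)
        (\<lambda>s. output_roabp s = refutation_roabp n \<alpha> \<beta> vs)"
      using runs_refutation_program[OF that refl] time_le_poly_bound[OF a] by (rule runs_mono)
    then show "constructs_within refutation_program (poly_bound ?a n) n \<alpha> \<beta> vs (refutation_roabp n \<alpha> \<beta> vs)"
      unfolding runs_def constructs_within_def .
  qed
  then show "\<exists>C. IPS_LIN_refutation n (subset_sum_poly n \<alpha> \<beta>) C \<and> individual_degree C \<le> 2 \<and>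
         (\<forall>vs. variable_order n vs \<longrightarrow> (\<exists>B. roabp_computes (poly_bound ?a n) vs B C \<and>
            constructs_within refutation_program (poly_bound ?a n) n \<alpha> \<beta> vs B))"
    using certificate_refutes[OF \<beta>] individual_degree_certificate[of n \<alpha> \<beta>]
    by (intro exI[of _ ?C]) auto
qed

end
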